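(* Let $M$ be a Riemannian manifold and $f:M\to\mathbb{R}$ a differentiable function such that $\operatorname{grad} f$ is $L$-Lipschitz continuous for some $L\ge 0$ and such that $f$ has a global minimizer, with optimal value $f^*$. Let $\eta>0$, let $x_0\in M$ with $\operatorname{grad} f(x_0)\neq 0$, and let $\{x_k\}_{k\ge 0}$ be generated by MAdaGrad from $x_0$ with parameter $\eta$. Set $$\alpha_{\min}=\left(L+\frac{2(f(x_0)-f^* )}{\eta^2}+\frac{\eta^2L^3}{\|\operatorname{grad} f(x_0)\|^2}\right)^{-1}.$$ Given $\epsilon>0$, let $T_g(\epsilon)=\inf\{k\in\mathbb{N}: \|\operatorname{grad} f(x_k)\|\le\epsilon\}$. Then $$T_g(\epsilon)\le\left[\frac{\eta^3L^2}{\alpha_{\min}\|\operatorname{grad} f(x_0)\|}+\frac{2(f(x_0)-f^* )}{\alpha_{\min}}+\frac{\eta^4L^3}{\alpha_{\min}\|\operatorname{grad} f(x_0)\|^2}\right]\epsilon^{-2}.$$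
   Context: All manifolds are connected, finite dimensional and complete Riemannian manifolds; $\|\cdot\|$ is the norm of the Riemannian metric on tangent spaces, $d$ the Riemannian distance, $\operatorname{grad} f$ the Riemannian gradient, $\exp_p:T_pM\to M$ the exponential map; $\mathbb{N}$ includes $0$. Given $L\ge 0$, $\operatorname{grad} f$ is $L$-Lipschitz continuous if for any $p,q\in M$ and any geodesic segment $\gamma$ joining $p$ to $q$, $\|P_{\gamma,p,q}\operatorname{grad} f(p)-\operatorname{grad} f(q)\|\le L\,d(p,q)$, where $P_{\gamma,p,q}$ is the parallel transport along $\gamma$ from $p$ to $q$. MAdaGrad (Algorithm 1): given $x_0\in M$ and $\eta>0$, set $\beta_0=0$; for $k=0,1,2,\dots$, stop if $\operatorname{grad} f(x_k)=0$, and otherwise set $$\beta_{k+1}=\beta_k+\|\operatorname{grad} f(x_k)\|^2,\qquad \alpha_k=\frac{\eta}{\sqrt{\beta_{k+1}}},\qquad x_{k+1}=\exp_{x_k}\left(-\alpha_k\operatorname{grad} f(x_k)\right).$$ Convention: when $\operatorname{grad} f(x_0)\ne 0$, these three formulas make sense for all $k\ge 0$, and if the algorithm stops at some iterate the sequences are continued by the same formulas (so $x_k$, $\beta_k$ and $\alpha_k$ stay constant from then on). *)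

theory Defs
  imports "HOL-Analysis.Analysis"
begin

section \<open>Smooth maps\<close>

primrec C_k_on :: "nat \<Rightarrow> 'a::real_normed_vector set \<Rightarrow> ('a \<Rightarrow> 'b::real_normed_vector) \<Rightarrow> bool" where
  "C_k_on 0 S f \<longleftrightarrow> continuous_on S f"
| "C_k_on (Suc k) S f \<longleftrightarrow>
     (\<forall>x\<in>S. f differentiable (at x)) \<and> (\<forall>v. C_k_on k S (\<lambda>x. frechet_derivative f (at x) v))"

text \<open>Only used for open \<open>S\<close>: the derivatives above are two-sided.\<close>
definition smooth_on :: "'a::real_normed_vector set \<Rightarrow> ('a \<Rightarrow> 'b::real_normed_vector) \<Rightarrow> bool" where
  "smooth_on S f \<longleftrightarrow> (\<forall>k. C_k_on k S f)"


section \<open>Riemannian manifolds\<close>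

text \<open>
  The points of the manifold are all elements of the type \<open>'m\<close>, whose topology is the manifold
  topology; \<open>'e\<close> is the Euclidean model space, so the dimension is \<open>DIM('e)\<close>. A chart \<open>(U, \<phi>)\<close> is
  a coordinate map \<open>\<phi>\<close> together with its domain \<open>U\<close>.

  A tangent vector at \<open>p\<close> is given by its components in all the charts around \<open>p\<close>, which are
  related by the derivatives of the coordinate changes; the components in the remaining charts are
  set to zero, so that vectors are determined by their meaningful components. The vector space
  operations are therefore componentwise: \<open>v - w\<close> is the library's difference of functions, and
  \<open>a\<close> times \<open>v\<close> is \<open>\<lambda>c. a *\<^sub>R v c\<close>.
\<close>

type_synonym ('m, 'e) chart = "'m set \<times> ('m \<Rightarrow> 'e)"
type_synonym ('m, 'e) tangent = "('m, 'e) chart \<Rightarrow> 'e"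

record ('m, 'e) riemannian =
  atlas :: "('m, 'e) chart set"
  metric :: "'m \<Rightarrow> ('m, 'e) tangent \<Rightarrow> ('m, 'e) tangent \<Rightarrow> real"

abbreviation chart_inv :: "('m, 'e) chart \<Rightarrow> 'e \<Rightarrow> 'm" where
  "chart_inv c \<equiv> inv_into (fst c) (snd c)"

definition smooth_atlas ::
    "('m::topological_space, 'e::euclidean_space) chart set \<Rightarrow> bool" where
  "smooth_atlas A \<longleftrightarrow>
     (\<Union>c\<in>A. fst c) = UNIV \<and>
     (\<forall>c\<in>A. open (fst c) \<and> open (snd c ` fst c) \<and>
        homeomorphism (fst c) (snd c ` fst c) (snd c) (chart_inv c)) \<and>
     (\<forall>c\<in>A. \<forall>c'\<in>A. smooth_on (snd c ` (fst c \<inter> fst c')) (snd c' \<circ> chart_inv c))"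

definition charts_at :: "('m, 'e) riemannian \<Rightarrow> 'm \<Rightarrow> ('m, 'e) chart set" where
  "charts_at M p = {c \<in> atlas M. p \<in> fst c}"

definition tangent_space ::
    "('m, 'e::euclidean_space) riemannian \<Rightarrow> 'm \<Rightarrow> ('m, 'e) tangent set" where
  "tangent_space M p =
     {v. (\<forall>c. c \<notin> charts_at M p \<longrightarrow> v c = 0) \<and>
         (\<forall>c\<in>charts_at M p. \<forall>c'\<in>charts_at M p.
            v c' = frechet_derivative (snd c' \<circ> chart_inv c) (at (snd c p)) (v c))}"

text \<open>The tangent vector at \<open>p\<close> whose component in the chart \<open>c\<close> is \<open>u\<close>.\<close>
definition tangent_of ::
    "('m, 'e::euclidean_space) riemannian \<Rightarrow> ('m, 'e) chart \<Rightarrow> 'm \<Rightarrow> 'e \<Rightarrow> ('m, 'e) tangent" where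
  "tangent_of M c p u =
     (\<lambda>c'. if c' \<in> charts_at M p
           then frechet_derivative (snd c' \<circ> chart_inv c) (at (snd c p)) u else 0)"

text \<open>The metric in the coordinates \<open>c\<close>: \<open>u, w \<mapsto> \<Sum>\<^sub>i\<^sub>j g\<^sub>i\<^sub>j(x) u\<^sub>i w\<^sub>j\<close> at \<open>x \<in> snd c ` fst c\<close>.\<close>
definition local_metric ::
    "('m, 'e::euclidean_space) riemannian \<Rightarrow> ('m, 'e) chart \<Rightarrow> 'e \<Rightarrow> 'e \<Rightarrow> 'e \<Rightarrow> real" where
  "local_metric M c x u w =
     metric M (chart_inv c x) (tangent_of M c (chart_inv c x) u) (tangent_of M c (chart_inv c x) w)"

definition riemannian_manifold ::
    "('m::{t2_space, second_countable_topology}, 'e::euclidean_space) riemannian \<Rightarrow> bool" where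
  "riemannian_manifold M \<longleftrightarrow>
     connected (UNIV :: 'm set) \<and>
     smooth_atlas (atlas M) \<and>
     (\<forall>p. \<forall>u\<in>tangent_space M p. \<forall>v\<in>tangent_space M p. metric M p u v = metric M p v u) \<and>
     (\<forall>p. \<forall>u\<in>tangent_space M p. \<forall>v\<in>tangent_space M p. \<forall>w\<in>tangent_space M p. \<forall>a b.
        metric M p (\<lambda>c. a *\<^sub>R u c + b *\<^sub>R v c) w = a * metric M p u w + b * metric M p v w) \<and>
     (\<forall>p. \<forall>v\<in>tangent_space M p. v \<noteq> (\<lambda>_. 0) \<longrightarrow> metric M p v v > 0) \<and>
     (\<forall>c\<in>atlas M. \<forall>u w. smooth_on (snd c ` fst c) (\<lambda>x. local_metric M c x u w))"

definition tnorm ::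
    "('m, 'e) riemannian \<Rightarrow> 'm \<Rightarrow> ('m, 'e) tangent \<Rightarrow> real" where
  "tnorm M p v = sqrt (metric M p v v)"


section \<open>Curves and Riemannian distance\<close>

text \<open>At an endpoint of the interval \<open>I\<close> the derivative is one-sided.\<close>
definition velocity ::
    "('m, 'e::euclidean_space) riemannian \<Rightarrow> real set \<Rightarrow> (real \<Rightarrow> 'm) \<Rightarrow> real \<Rightarrow> ('m, 'e) tangent" where
  "velocity M I \<gamma> t =
     (\<lambda>c. if c \<in> charts_at M (\<gamma> t) then vector_derivative (snd c \<circ> \<gamma>) (at t within I) else 0)"

definition differentiable_curve_on ::
    "('m::topological_space, 'e::euclidean_space) riemannian \<Rightarrow> real set \<Rightarrow> (real \<Rightarrow> 'm) \<Rightarrow> bool" where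
  "differentiable_curve_on M I \<gamma> \<longleftrightarrow>
     continuous_on I \<gamma> \<and>
     (\<forall>t\<in>I. \<forall>c\<in>charts_at M (\<gamma> t). (snd c \<circ> \<gamma>) differentiable (at t within I))"

definition C1_curve_on ::
    "('m::topological_space, 'e::euclidean_space) riemannian \<Rightarrow> real set \<Rightarrow> (real \<Rightarrow> 'm) \<Rightarrow> bool" where
  "C1_curve_on M I \<gamma> \<longleftrightarrow>
     differentiable_curve_on M I \<gamma> \<and>
     (\<forall>c\<in>atlas M. continuous_on {t\<in>I. \<gamma> t \<in> fst c} (\<lambda>t. velocity M I \<gamma> t c))"

text \<open>Piecewise \<open>C\<^sup>1\<close> curves with subdivision \<open>\<tau> 0 < \<dots> < \<tau> n\<close>; each closed piece is \<open>C\<^sup>1\<close> up to its ends.\<close>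
definition piecewise_C1_curve ::
    "('m::topological_space, 'e::euclidean_space) riemannian \<Rightarrow>
       nat \<Rightarrow> (nat \<Rightarrow> real) \<Rightarrow> (real \<Rightarrow> 'm) \<Rightarrow> bool" where
  "piecewise_C1_curve M n \<tau> \<gamma> \<longleftrightarrow>
     (\<forall>i<n. \<tau> i < \<tau> (Suc i) \<and> C1_curve_on M {\<tau> i..\<tau> (Suc i)} \<gamma>)"

definition curve_length ::
    "('m, 'e::euclidean_space) riemannian \<Rightarrow> nat \<Rightarrow> (nat \<Rightarrow> real) \<Rightarrow> (real \<Rightarrow> 'm) \<Rightarrow> real" where
  "curve_length M n \<tau> \<gamma> =
     (\<Sum>i<n. integral {\<tau> i..\<tau> (Suc i)}
               (\<lambda>t. tnorm M (\<gamma> t) (velocity M {\<tau> i..\<tau> (Suc i)} \<gamma> t)))"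

definition riem_dist ::
    "('m::topological_space, 'e::euclidean_space) riemannian \<Rightarrow> 'm \<Rightarrow> 'm \<Rightarrow> real" where
  "riem_dist M p q =
     Inf {curve_length M n \<tau> \<gamma> | n \<tau> \<gamma>. piecewise_C1_curve M n \<tau> \<gamma> \<and> \<gamma> (\<tau> 0) = p \<and> \<gamma> (\<tau> n) = q}"


section \<open>Levi-Civita connection along curves\<close>

text \<open>
  \<open>christoffel M c x u w = \<Sum>\<^sub>i\<^sub>j \<Gamma>\<^sub>i\<^sub>j\<^sup>k(x) u\<^sub>i w\<^sub>j\<close>, the component in the chart \<open>c\<close> of the Levi-Civita
  derivative of the constant coordinate field \<open>w\<close> in the direction \<open>u\<close>. It is determined by
  Koszul's formula, in which the Lie brackets of constant coordinate fields vanish.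
\<close>
definition christoffel ::
    "('m, 'e::euclidean_space) riemannian \<Rightarrow> ('m, 'e) chart \<Rightarrow> 'e \<Rightarrow> 'e \<Rightarrow> 'e \<Rightarrow> 'e" where
  "christoffel M c x u w =
     (THE z. \<forall>y. 2 * local_metric M c x z y =
        frechet_derivative (\<lambda>x. local_metric M c x w y) (at x) u
      + frechet_derivative (\<lambda>x. local_metric M c x u y) (at x) w
      - frechet_derivative (\<lambda>x. local_metric M c x u w) (at x) y)"

text \<open>In coordinates, a vector field \<open>V\<close> along \<open>\<gamma>\<close> is parallel iff \<open>V' + \<Gamma>(\<gamma>', V) = 0\<close>.\<close>
definition parallel_on ::
    "('m, 'e::euclidean_space) riemannian \<Rightarrow> real set \<Rightarrow> (real \<Rightarrow> 'm) \<Rightarrow>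
       (real \<Rightarrow> ('m, 'e) tangent) \<Rightarrow> bool" where
  "parallel_on M I \<gamma> V \<longleftrightarrow>
     (\<forall>t\<in>I. V t \<in> tangent_space M (\<gamma> t)) \<and>
     (\<forall>t\<in>I. \<forall>c\<in>charts_at M (\<gamma> t).
        ((\<lambda>s. V s c) has_vector_derivative
           - christoffel M c (snd c (\<gamma> t)) (velocity M I \<gamma> t c) (V t c)) (at t within I))"

definition geodesic_on ::
    "('m::topological_space, 'e::euclidean_space) riemannian \<Rightarrow> real set \<Rightarrow> (real \<Rightarrow> 'm) \<Rightarrow> bool" where
  "geodesic_on M I \<gamma> \<longleftrightarrow>
     differentiable_curve_on M I \<gamma> \<and> parallel_on M I \<gamma> (velocity M I \<gamma>)"

text \<open>
  The choice operators in \<open>parallel_transport\<close> and \<open>riem_exp\<close> select the only candidate, by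
  uniqueness for the two ordinary differential equations.
\<close>
definition parallel_transport ::
    "('m, 'e::euclidean_space) riemannian \<Rightarrow> real \<Rightarrow> real \<Rightarrow> (real \<Rightarrow> 'm) \<Rightarrow>
       ('m, 'e) tangent \<Rightarrow> ('m, 'e) tangent" where
  "parallel_transport M a b \<gamma> u =
     (SOME w. \<exists>V. parallel_on M {a..b} \<gamma> V \<and> V a = u \<and> V b = w)"

definition riem_exp ::
    "('m::topological_space, 'e::euclidean_space) riemannian \<Rightarrow> 'm \<Rightarrow> ('m, 'e) tangent \<Rightarrow> 'm" where
  "riem_exp M p v =
     (SOME q. \<exists>\<gamma>. geodesic_on M UNIV \<gamma> \<and> \<gamma> 0 = p \<and> velocity M UNIV \<gamma> 0 = v \<and> \<gamma> 1 = q)"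

text \<open>Completeness: every geodesic extends to the whole real line.\<close>
definition complete_riemannian_manifold ::
    "('m::{t2_space, second_countable_topology}, 'e::euclidean_space) riemannian \<Rightarrow> bool" where
  "complete_riemannian_manifold M \<longleftrightarrow>
     riemannian_manifold M \<and>
     (\<forall>p. \<forall>v\<in>tangent_space M p.
        \<exists>\<gamma>. geodesic_on M UNIV \<gamma> \<and> \<gamma> 0 = p \<and> velocity M UNIV \<gamma> 0 = v)"


section \<open>Gradients\<close>

definition differentiable_fun ::
    "('m, 'e::euclidean_space) riemannian \<Rightarrow> ('m \<Rightarrow> real) \<Rightarrow> bool" where
  "differentiable_fun M f \<longleftrightarrow>
     (\<forall>p. \<forall>c\<in>charts_at M p. (f \<circ> chart_inv c) differentiable (at (snd c p)))"

text \<open>The gradient represents the differential: \<open>\<langle>grad f(p), w\<rangle> = df\<^sub>p(w)\<close>, the latter computed in any chart.\<close>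
definition grad ::
    "('m, 'e::euclidean_space) riemannian \<Rightarrow> ('m \<Rightarrow> real) \<Rightarrow> 'm \<Rightarrow> ('m, 'e) tangent" where
  "grad M f p =
     (THE v. v \<in> tangent_space M p \<and>
        (\<forall>w\<in>tangent_space M p. \<forall>c\<in>charts_at M p.
           metric M p v w = frechet_derivative (f \<circ> chart_inv c) (at (snd c p)) (w c)))"

definition lipschitz_grad ::
    "('m::topological_space, 'e::euclidean_space) riemannian \<Rightarrow> ('m \<Rightarrow> real) \<Rightarrow> real \<Rightarrow> bool" where
  "lipschitz_grad M f L \<longleftrightarrow>
     (\<forall>p q a b \<gamma>. a < b \<and> geodesic_on M {a..b} \<gamma> \<and> \<gamma> a = p \<and> \<gamma> b = q \<longrightarrow>
        tnorm M q (parallel_transport M a b \<gamma> (grad M f p) - grad M f q) \<le> L * riem_dist M p q)"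


section \<open>The MAdaGrad algorithm\<close>

text \<open>
  The stopping test is dropped, so the iteration is continued by the same formulas past a critical
  point, where the iterates stay constant.
\<close>
definition madagrad ::
    "('m::topological_space, 'e::euclidean_space) riemannian \<Rightarrow> ('m \<Rightarrow> real) \<Rightarrow> real \<Rightarrow> 'm \<Rightarrow>
       (nat \<Rightarrow> 'm) \<Rightarrow> (nat \<Rightarrow> real) \<Rightarrow> (nat \<Rightarrow> real) \<Rightarrow> bool" where
  "madagrad M f \<eta> x0 x \<beta> \<alpha> \<longleftrightarrow>
     x 0 = x0 \<and> \<beta> 0 = 0 \<and>
     (\<forall>k. \<beta> (Suc k) = \<beta> k + (tnorm M (x k) (grad M f (x k)))\<^sup>2 \<and>
          \<alpha> k = \<eta> / sqrt (\<beta> (Suc k)) \<and>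
          x (Suc k) = riem_exp M (x k) (\<lambda>c. (- \<alpha> k) *\<^sub>R grad M f (x k) c))"

text \<open>The first index with gradient norm at most \<open>\<epsilon>\<close>; it is \<open>\<infinity>\<close> if there is none.\<close>
definition first_stationary ::
    "('m, 'e::euclidean_space) riemannian \<Rightarrow> ('m \<Rightarrow> real) \<Rightarrow> (nat \<Rightarrow> 'm) \<Rightarrow> real \<Rightarrow> enat" where
  "first_stationary M f x \<epsilon> = Inf {enat k | k. tnorm M (x k) (grad M f (x k)) \<le> \<epsilon>}"

end

theory Submission
  imports Defs
begin

text \<open>
  Along a geodesic \<open>\<gamma>\<close> with constant speed \<open>s\<close>, the slope \<open>(f \<circ> \<gamma>)' = \<langle>grad f, \<gamma>'\<rangle>\<close> satisfies
  \<open>(f \<circ> \<gamma>)'(b) - (f \<circ> \<gamma>)'(a) \<le> L (b - a) s\<^sup>2\<close>: parallel transport along \<open>\<gamma>\<close> is isometric and fixes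
  \<open>\<gamma>'\<close>, so the Lipschitz condition applies to the component along \<open>\<gamma>'\<close>. The bound is additive in
  \<open>[a, b]\<close>, so parallel fields are only needed over short pieces inside one chart, where they solve a
  linear differential equation. Integrating gives the descent inequality
  \<open>f (exp\<^sub>p v) \<le> f p + \<langle>grad f p, v\<rangle> + L/2 \<parallel>v\<parallel>\<^sup>2\<close>.

  For the iterates, steps with \<open>\<alpha>\<^sub>k \<le> 1/L\<close> decrease \<open>f\<close> by at least \<open>\<alpha>\<^sub>k \<parallel>grad f(x\<^sub>k)\<parallel>\<^sup>2 / 2\<close>, while the
  earlier ones happen only as long as \<open>\<beta>\<close> is at most \<open>\<eta>\<^sup>2 L\<^sup>2\<close> and increase \<open>f\<close> by a bounded amount in
  total. Summing bounds \<open>\<beta>\<^sub>n\<close>, the sum of the first \<open>n\<close> squared gradient norms, uniformly in \<open>n\<close>.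
\<close>

subsection \<open>Calculus\<close>

text \<open>\<open>parallel_transport\<close> and \<open>riem_exp\<close> are choice operators, so a
  statement about them carries information only where a parallel field or a geodesic is known to
  exist. Completeness supplies the geodesics; the existence of parallel fields has to be proved
  before the Lipschitz condition can be used at all. Whichever candidate the choice picks serves:
  every parallel field along a geodesic keeps its inner product with the velocity. Most of the
  geometry goes into one point: a field constructed in one chart must satisfy the parallel equation
  in every other chart. This requires the transformation law of the Christoffel symbols, and hence
  the symmetry of second derivatives. In the recursion, let E bound twice the drop of f once the
  steps are short. Then \<beta>_n is at most E sqrt(\<beta>_n) / \<eta> plus an early part that is
  again at most a multiple of sqrt(\<beta>_n). Cancelling sqrt(\<beta>_n) gives sqrt(\<beta>_n) /
  \<eta> \<le> L + E / \<eta>^2, and the right side is 1 / \<alpha>_min. So \<alpha>_min is a lower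
  bound for the step sizes.\<close>

lemma smooth_on_continuous: "smooth_on S f \<Longrightarrow> continuous_on S f"
  unfolding smooth_on_def by (metis C_k_on.simps(1))

lemma smooth_on_differentiable: "smooth_on S f \<Longrightarrow> x \<in> S \<Longrightarrow> f differentiable (at x)"
  unfolding smooth_on_def by (metis C_k_on.simps(2))

lemma smooth_on_has_derivative:
  "smooth_on S f \<Longrightarrow> x \<in> S \<Longrightarrow> (f has_derivative frechet_derivative f (at x)) (at x)"
  using smooth_on_differentiable frechet_derivative_works by blast

lemma smooth_on_frechet_derivative:
  "smooth_on S f \<Longrightarrow> smooth_on S (\<lambda>x. frechet_derivative f (at x) v)"
  unfolding smooth_on_def by (metis C_k_on.simps(2))

section \<open>Symmetry of second derivatives\<close>

text \<open>Two applications of the mean value theorem: along \<open>u\<close> to the difference of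
  \<open>f\<close> on two opposite sides of the parallelogram, then along \<open>w\<close> to the
  derivative in direction \<open>u\<close>. The left side is symmetric in \<open>u\<close> and
  \<open>w\<close>, which is the point of computing it.\<close>

lemma second_difference_mean_value:
  fixes f :: "'a::real_normed_vector \<Rightarrow> real"
  assumes D: "\<And>y. y \<in> ball x r \<Longrightarrow> (f has_derivative D y) (at y)"
    and D2: "\<And>y. y \<in> ball x r \<Longrightarrow> ((\<lambda>y. D y u) has_derivative D2 y) (at y)"
    and h: "h > 0" "h * (norm u + norm w) < r"
  shows "\<exists>s t. 0 < s \<and> s < h \<and> 0 < t \<and> t < h \<and>
    f (x + h *\<^sub>R u + h *\<^sub>R w) - f (x + h *\<^sub>R u) - f (x + h *\<^sub>R w) + f x
      = h\<^sup>2 * D2 (x + s *\<^sub>R u + t *\<^sub>R w) w"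
proof -
  have inb: "x + s *\<^sub>R u + t *\<^sub>R w \<in> ball x r" if "0 \<le> s" "s \<le> h" "0 \<le> t" "t \<le> h" for s t
  proof -
    have "norm (s *\<^sub>R u + t *\<^sub>R w) \<le> s * norm u + t * norm w"
      using norm_triangle_ineq[of "s *\<^sub>R u" "t *\<^sub>R w"] that by simp
    also have "\<dots> \<le> h * norm u + h * norm w"
      using that by (intro add_mono mult_right_mono) auto
    finally have "norm (s *\<^sub>R u + t *\<^sub>R w) < r" using h by (simp add: algebra_simps)
    moreover have "dist x (x + s *\<^sub>R u + t *\<^sub>R w) = norm (s *\<^sub>R u + t *\<^sub>R w)"
      by (metis add.assoc dist_add_cancel dist_0_norm add_0_right)
    ultimately show ?thesis by simp
  qed
  have der1: "((\<lambda>s. f (x + s *\<^sub>R u + t *\<^sub>R w)) has_real_derivative D (x + s *\<^sub>R u + t *\<^sub>R w) u) (at s)"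
    if "0 \<le> s" "s \<le> h" "0 \<le> t" "t \<le> h" for s t
  proof -
    have a: "((\<lambda>s. x + s *\<^sub>R u + t *\<^sub>R w) has_derivative (\<lambda>k. k *\<^sub>R u)) (at s)"
      by (auto intro!: derivative_eq_intros)
    have "((\<lambda>s. f (x + s *\<^sub>R u + t *\<^sub>R w)) has_derivative
        (\<lambda>k. D (x + s *\<^sub>R u + t *\<^sub>R w) (k *\<^sub>R u))) (at s)"
      by (rule has_derivative_compose[OF a D[OF inb[OF that]]])
    moreover have "linear (D (x + s *\<^sub>R u + t *\<^sub>R w))"
      using D[OF inb[OF that]] has_derivative_linear by blast
    ultimately show ?thesis
      by (simp add: has_field_derivative_def linear_cmul mult_commute_abs)
  qed
  have der2: "((\<lambda>t. D (x + s *\<^sub>R u + t *\<^sub>R w) u) has_real_derivative D2 (x + s *\<^sub>R u + t *\<^sub>R w) w) (at t)"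
    if "0 \<le> s" "s \<le> h" "0 \<le> t" "t \<le> h" for s t
  proof -
    have a: "((\<lambda>t. x + s *\<^sub>R u + t *\<^sub>R w) has_derivative (\<lambda>k. k *\<^sub>R w)) (at t)"
      by (auto intro!: derivative_eq_intros)
    have "((\<lambda>t. D (x + s *\<^sub>R u + t *\<^sub>R w) u) has_derivative
        (\<lambda>k. D2 (x + s *\<^sub>R u + t *\<^sub>R w) (k *\<^sub>R w))) (at t)"
      by (rule has_derivative_compose[OF a D2[OF inb[OF that]]])
    moreover have "linear (D2 (x + s *\<^sub>R u + t *\<^sub>R w))"
      using D2[OF inb[OF that]] has_derivative_linear by blast
    ultimately show ?thesis
      by (simp add: has_field_derivative_def linear_cmul mult_commute_abs)
  qed
  define g where "g s = f (x + s *\<^sub>R u + h *\<^sub>R w) - f (x + s *\<^sub>R u + 0 *\<^sub>R w)" for s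
  have "\<exists>s>0. s < h \<and> g h - g 0 = (h - 0) *
      (D (x + s *\<^sub>R u + h *\<^sub>R w) u - D (x + s *\<^sub>R u + 0 *\<^sub>R w) u)"
    unfolding g_def using h
    by (intro MVT2[OF h(1)] DERIV_diff der1) auto
  then obtain s where s: "0 < s" "s < h"
    "g h - g 0 = h * (D (x + s *\<^sub>R u + h *\<^sub>R w) u - D (x + s *\<^sub>R u + 0 *\<^sub>R w) u)" by auto
  have "\<exists>t>0. t < h \<and> D (x + s *\<^sub>R u + h *\<^sub>R w) u - D (x + s *\<^sub>R u + 0 *\<^sub>R w) u
      = (h - 0) * D2 (x + s *\<^sub>R u + t *\<^sub>R w) w"
    using s by (intro MVT2[OF h(1)] der2) auto
  then obtain t where t: "0 < t" "t < h" "D (x + s *\<^sub>R u + h *\<^sub>R w) u - D (x + s *\<^sub>R u + 0 *\<^sub>R w) u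
      = (h - 0) * D2 (x + s *\<^sub>R u + t *\<^sub>R w) w" by auto
  have "g h - g 0 = f (x + h *\<^sub>R u + h *\<^sub>R w) - f (x + h *\<^sub>R u) - f (x + h *\<^sub>R w) + f x"
    by (simp add: g_def)
  then show ?thesis using s t by (intro exI[of _ s] exI[of _ t]) (simp add: power2_eq_square)
qed

text \<open>The second difference over a small parallelogram can be evaluated with the roles of
  \<open>u\<close> and \<open>w\<close> exchanged, so the two mixed derivatives agree at two nearby
  points; continuity at \<open>x\<close> carries the equality to \<open>x\<close>. Here
  \<open>D2 u y\<close> is the derivative at \<open>y\<close> of the directional derivative along
  \<open>u\<close>.\<close>

lemma symmetric_second_derivative_real:
  fixes f :: "'a::real_normed_vector \<Rightarrow> real"
  assumes S: "open S" "x \<in> S"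
    and D: "\<And>y. y \<in> S \<Longrightarrow> (f has_derivative D y) (at y)"
    and D2: "\<And>y u. y \<in> S \<Longrightarrow> ((\<lambda>y. D y u) has_derivative D2 u y) (at y)"
    and cont: "\<And>u w. continuous_on S (\<lambda>y. D2 u y w)"
  shows "D2 u x w = D2 w x u"
proof (rule ccontr)
  assume "D2 u x w \<noteq> D2 w x u"
  \<comment> \<open>Half the gap: two errors, each below \<open>e\<close>, cannot add up to the
    gap.\<close>
  define e where "e = \<bar>D2 u x w - D2 w x u\<bar> / 2"
  have e: "e > 0" using \<open>D2 u x w \<noteq> D2 w x u\<close> by (simp add: e_def)
  obtain r where r: "r > 0" "ball x r \<subseteq> S" using S openE by blast
  have nbhd: "\<exists>d>0. \<forall>y\<in>ball x d. \<bar>D2 u y w - D2 u x w\<bar> < e" for u w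
  proof -
    have "continuous (at x) (\<lambda>y. D2 u y w)"
      using cont S continuous_on_eq_continuous_at by blast
    then obtain d where "d > 0" "\<And>y. dist y x < d \<Longrightarrow> dist (D2 u y w) (D2 u x w) < e"
      using e unfolding continuous_at_eps_delta by meson
    then show ?thesis by (auto simp: dist_real_def dist_commute)
  qed
  obtain d1 where d1: "d1 > 0" "\<And>y. y \<in> ball x d1 \<Longrightarrow> \<bar>D2 u y w - D2 u x w\<bar> < e"
    using nbhd by meson
  obtain d2 where d2: "d2 > 0" "\<And>y. y \<in> ball x d2 \<Longrightarrow> \<bar>D2 w y u - D2 w x u\<bar> < e"
    using nbhd by meson
  define d where "d = min r (min d1 d2)"
  \<comment> \<open>The summand 1 keeps the denominator positive when \<open>u\<close> and
    \<open>w\<close> vanish and makes the parallelogram fit strictly inside the ball of radius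
    \<open>d\<close>.\<close>
  define h where "h = d / (norm u + norm w + 1)"
  have d: "d > 0" using r d1 d2 by (simp add: d_def)
  have h: "h > 0" using d by (simp add: h_def add_nonneg_pos)
  have "h * (norm u + norm w + 1) = d"
    using add_nonneg_pos[of "norm u + norm w" 1] by (simp add: h_def)
  then have hd: "h * (norm u + norm w) < d" using h by (simp add: distrib_left)
  then have hd': "h * (norm w + norm u) < d" by (simp add: add.commute)
  have inb: "x + s *\<^sub>R u + t *\<^sub>R w \<in> ball x d" if "0 < s" "s < h" "0 < t" "t < h" for s t
  proof -
    have "norm (s *\<^sub>R u + t *\<^sub>R w) \<le> s * norm u + t * norm w"
      using norm_triangle_ineq[of "s *\<^sub>R u" "t *\<^sub>R w"] that by simp
    also have "\<dots> \<le> h * norm u + h * norm w"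
      using that by (intro add_mono mult_right_mono) auto
    finally have "norm (s *\<^sub>R u + t *\<^sub>R w) < d" using hd by (simp add: algebra_simps)
    moreover have "dist x (x + s *\<^sub>R u + t *\<^sub>R w) = norm (s *\<^sub>R u + t *\<^sub>R w)"
      by (metis add.assoc dist_add_cancel dist_0_norm add_0_right)
    ultimately show ?thesis by simp
  qed
  have sub: "ball x d \<subseteq> S" using r by (auto simp: d_def)
  obtain s t where st: "0 < s" "s < h" "0 < t" "t < h"
    "f (x + h *\<^sub>R u + h *\<^sub>R w) - f (x + h *\<^sub>R u) - f (x + h *\<^sub>R w) + f x
      = h\<^sup>2 * D2 u (x + s *\<^sub>R u + t *\<^sub>R w) w"
    using second_difference_mean_value[OF D[OF subsetD[OF sub]] D2[OF subsetD[OF sub]] h hd]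
    by blast
  obtain t' s' where st': "0 < t'" "t' < h" "0 < s'" "s' < h"
    "f (x + h *\<^sub>R w + h *\<^sub>R u) - f (x + h *\<^sub>R w) - f (x + h *\<^sub>R u) + f x
      = h\<^sup>2 * D2 w (x + t' *\<^sub>R w + s' *\<^sub>R u) u"
    using second_difference_mean_value[OF D[OF subsetD[OF sub]] D2[OF subsetD[OF sub]] h(1) hd']
    by blast
  have "h\<^sup>2 * D2 u (x + s *\<^sub>R u + t *\<^sub>R w) w = h\<^sup>2 * D2 w (x + s' *\<^sub>R u + t' *\<^sub>R w) u"
    using st(5) st'(5) by (simp add: algebra_simps)
  then have "D2 u (x + s *\<^sub>R u + t *\<^sub>R w) w = D2 w (x + s' *\<^sub>R u + t' *\<^sub>R w) u"
    using h by simp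
  moreover have "\<bar>D2 u (x + s *\<^sub>R u + t *\<^sub>R w) w - D2 u x w\<bar> < e"
    using inb[OF st(1-4)] by (intro d1) (simp add: d_def)
  moreover have "\<bar>D2 w (x + s' *\<^sub>R u + t' *\<^sub>R w) u - D2 w x u\<bar> < e"
    using inb[OF st'(3,4,1,2)] by (intro d2) (simp add: d_def)
  ultimately have "\<bar>D2 u x w - D2 w x u\<bar> < e + e" by linarith
  then show False by (simp add: e_def)
qed

lemma symmetric_second_derivative:
  fixes f :: "'a::real_normed_vector \<Rightarrow> 'b::euclidean_space"
  assumes S: "open S" "x \<in> S" and f: "smooth_on S f"
  shows "frechet_derivative (\<lambda>y. frechet_derivative f (at y) u) (at x) w
       = frechet_derivative (\<lambda>y. frechet_derivative f (at y) w) (at x) u"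
proof (rule euclidean_eqI)
  fix b :: 'b
  show "frechet_derivative (\<lambda>y. frechet_derivative f (at y) u) (at x) w \<bullet> b
       = frechet_derivative (\<lambda>y. frechet_derivative f (at y) w) (at x) u \<bullet> b"
  proof (rule symmetric_second_derivative_real[OF S, where f = "\<lambda>y. f y \<bullet> b"
      and D = "\<lambda>y v. frechet_derivative f (at y) v \<bullet> b"
      and ?D2.0 = "\<lambda>u y w. frechet_derivative (\<lambda>y. frechet_derivative f (at y) u) (at y) w \<bullet> b"])
    show "((\<lambda>y. f y \<bullet> b) has_derivative (\<lambda>v. frechet_derivative f (at y) v \<bullet> b)) (at y)"
      if "y \<in> S" for y
      using smooth_on_has_derivative[OF f that] by (rule has_derivative_inner_left)
    show "((\<lambda>y. frechet_derivative f (at y) u \<bullet> b) has_derivative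
        (\<lambda>w. frechet_derivative (\<lambda>y. frechet_derivative f (at y) u) (at y) w \<bullet> b)) (at y)"
      if "y \<in> S" for y u
      using smooth_on_has_derivative[OF smooth_on_frechet_derivative[OF f] that]
      by (rule has_derivative_inner_left)
    show "continuous_on S
        (\<lambda>y. frechet_derivative (\<lambda>y. frechet_derivative f (at y) u) (at y) w \<bullet> b)" for u w
      by (intro continuous_intros smooth_on_continuous smooth_on_frechet_derivative f)
  qed
qed

section \<open>Families of linear maps and linear differential equations\<close>

lemma linear_expansion:
  fixes f :: "'a::euclidean_space \<Rightarrow> 'b::real_vector"
  assumes "linear f"
  shows "f y = (\<Sum>b\<in>Basis. (y \<bullet> b) *\<^sub>R f b)"
proof -
  have "f y = f (\<Sum>b\<in>Basis. (y \<bullet> b) *\<^sub>R b)" by (simp add: euclidean_representation)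
  also have "\<dots> = (\<Sum>b\<in>Basis. (y \<bullet> b) *\<^sub>R f b)" using assms by (simp add: linear_sum linear_cmul)
  finally show ?thesis .
qed

lemmas linear_functional_expansion = linear_expansion[where 'b = real, unfolded real_scaleR_def]

text \<open>Expanding \<open>y s - y t\<close> in a basis reduces joint differentiability to pointwise
  differentiability of the linear family.\<close>
lemma has_derivative_linear_family:
  fixes y :: "'s::real_normed_vector \<Rightarrow> 'a::euclidean_space"
    and F :: "'s \<Rightarrow> 'a \<Rightarrow> 'b::real_normed_vector"
  assumes tI: "t \<in> I" and lin: "\<forall>\<^sub>F s in at t within I. linear (F s)" "linear (F t)"
    and F: "\<And>v. ((\<lambda>s. F s v) has_derivative D v) (at t within I)"
    and y: "(y has_derivative y') (at t within I)"
  shows "((\<lambda>s. F s (y s)) has_derivative (\<lambda>h. D (y t) h + F t (y' h))) (at t within I)"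
proof -
  have repr: "F s (y s) = F s (y t) + (\<Sum>b\<in>Basis. ((y s - y t) \<bullet> b) *\<^sub>R F s b)" if "linear (F s)" for s
  proof -
    have "F s (y s) = F s (y t) + F s (y s - y t)"
      using that by (metis add_diff_cancel_left' add_diff_eq linear_add)
    also have "F s (y s - y t) = (\<Sum>b\<in>Basis. ((y s - y t) \<bullet> b) *\<^sub>R F s b)"
      by (rule linear_expansion[OF that])
    finally show ?thesis .
  qed
  have derF: "((\<lambda>s. ((y s - y t) \<bullet> b) *\<^sub>R F s b) has_derivative
      (\<lambda>h. ((y t - y t) \<bullet> b) *\<^sub>R D b h + (y' h \<bullet> b) *\<^sub>R F t b)) (at t within I)" for b
  proof -
    have "((\<lambda>s. (y s - y t) \<bullet> b) has_derivative (\<lambda>h. (y' h - 0) \<bullet> b)) (at t within I)"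
      by (intro has_derivative_inner_left has_derivative_diff y has_derivative_const)
    from has_derivative_scaleR[OF this F[of b]] show ?thesis by simp
  qed
  have "((\<lambda>s. F s (y t) + (\<Sum>b\<in>Basis. ((y s - y t) \<bullet> b) *\<^sub>R F s b)) has_derivative
      (\<lambda>h. D (y t) h + (\<Sum>b\<in>Basis. ((y t - y t) \<bullet> b) *\<^sub>R D b h + (y' h \<bullet> b) *\<^sub>R F t b))) (at t within I)"
    by (intro has_derivative_add F has_derivative_sum derF)
  moreover have "(\<lambda>h. D (y t) h + (\<Sum>b\<in>Basis. ((y t - y t) \<bullet> b) *\<^sub>R D b h + (y' h \<bullet> b) *\<^sub>R F t b))
      = (\<lambda>h. D (y t) h + F t (y' h))"
  proof
    fix h
    have "F t (y' h) = (\<Sum>b\<in>Basis. (y' h \<bullet> b) *\<^sub>R F t b)" by (rule linear_expansion[OF lin(2)])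
    then show "D (y t) h + (\<Sum>b\<in>Basis. ((y t - y t) \<bullet> b) *\<^sub>R D b h + (y' h \<bullet> b) *\<^sub>R F t b)
      = D (y t) h + F t (y' h)" by simp
  qed
  ultimately have main: "((\<lambda>s. F s (y t) + (\<Sum>b\<in>Basis. ((y s - y t) \<bullet> b) *\<^sub>R F s b)) has_derivative
      (\<lambda>h. D (y t) h + F t (y' h))) (at t within I)" by simp
  have "\<forall>\<^sub>F s in at t within I. F s (y t) + (\<Sum>b\<in>Basis. ((y s - y t) \<bullet> b) *\<^sub>R F s b) = F s (y s)"
    using lin(1) by eventually_elim (simp add: repr)
  then show ?thesis
    by (rule has_derivative_transform_eventually[OF main]) (simp_all add: tI)
qed

text \<open>Picard iteration; the interval is short enough for the plain supremum norm.\<close>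
lemma linear_ode_local_exists:
  fixes A :: "real \<Rightarrow> 'a::euclidean_space \<Rightarrow> 'a"
  assumes ab: "a \<le> b"
    and lin: "\<And>t. t \<in> {a..b} \<Longrightarrow> linear (A t)"
    and cont: "\<And>v. continuous_on {a..b} (\<lambda>t. A t v)"
    and bnd: "\<And>t v. t \<in> {a..b} \<Longrightarrow> norm (A t v) \<le> K * norm v"
    and K: "K * (b - a) < 1" "K \<ge> 0"
  shows "\<exists>y. y a = u \<and> (\<forall>t\<in>{a..b}. (y has_vector_derivative A t (y t)) (at t within {a..b}))"
proof -
  have contA: "continuous_on {a..b} (\<lambda>t. A t (z t))" if z: "continuous_on {a..b} z" for z
  proof -
    have "continuous_on {a..b} (\<lambda>t. \<Sum>i\<in>Basis. (z t \<bullet> i) *\<^sub>R A t i)"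
      by (intro continuous_intros cont z)
    moreover have "(\<Sum>i\<in>Basis. (z t \<bullet> i) *\<^sub>R A t i) = A t (z t)" if "t \<in> {a..b}" for t
      by (rule linear_expansion[OF lin[OF that], symmetric])
    ultimately show ?thesis by (rule continuous_on_eq)
  qed
  \<comment> \<open>Clamping to \<open>{a..b}\<close> turns a function on the interval into a
    bounded continuous function on the whole line. The Picard operator then acts on the type of
    bounded continuous functions, a complete metric space, where the Banach fixed point theorem
    applies.\<close>
  define cl where "cl t = max a (min b t)" for t :: real
  have cl_in: "cl t \<in> {a..b}" for t using ab by (auto simp: cl_def)
  have cl_id: "cl t = t" if "t \<in> {a..b}" for t using that by (auto simp: cl_def)
  have cl_cont: "continuous_on UNIV cl" unfolding cl_def by (intro continuous_intros)
  define P where "P z t = u + integral {a..t} (\<lambda>s. A s (z s))" for z t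
  have P_cont: "continuous_on {a..b} (P z)" if "continuous_on {a..b} z" for z
    unfolding P_def using contA[OF that]
    by (intro continuous_intros indefinite_integral_continuous_1 integrable_continuous_real)
  have Pcl: "(\<lambda>t. P z (cl t)) \<in> bcontfun" if "continuous_on {a..b} z" for z
  proof -
    have "compact (P z ` {a..b})" using P_cont[OF that] by (intro compact_continuous_image) auto
    then obtain B where "\<And>t. t \<in> {a..b} \<Longrightarrow> norm (P z t) \<le> B"
      using compact_imp_bounded bounded_iff by (metis image_eqI)
    moreover have "continuous_on UNIV (\<lambda>t. P z (cl t))"
      using P_cont[OF that] cl_cont cl_in
      by (intro continuous_on_compose2[OF P_cont[OF that] cl_cont]) auto
    ultimately show ?thesis using cl_in by (intro bcontfun_normI) auto
  qed
  define T where "T z = Bcontfun (\<lambda>t. P (apply_bcontfun z) (cl t))" for z :: "real \<Rightarrow>\<^sub>C 'a"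
  have T: "apply_bcontfun (T z) t = P (apply_bcontfun z) (cl t)" for z t
    unfolding T_def by (subst Bcontfun_inverse) (auto intro!: Pcl)
  have "\<exists>!z. T z = z"
  proof (rule banach_fix_type)
    show "0 \<le> K * (b - a)" using K ab by simp
    show "K * (b - a) < 1" by (fact K)
    show "\<forall>z1 z2. dist (T z1) (T z2) \<le> K * (b - a) * dist z1 z2"
    proof (intro allI dist_bound)
      fix z1 z2 :: "real \<Rightarrow>\<^sub>C 'a" and t
      let ?t = "cl t"
      have ct: "a \<le> ?t" "?t \<le> b" using cl_in[of t] by auto
      have int: "(\<lambda>s. A s (apply_bcontfun z s)) integrable_on {a..?t}" for z :: "real \<Rightarrow>\<^sub>C 'a"
        using ct by (intro integrable_continuous_real continuous_on_subset[OF contA]) auto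
      have "dist (apply_bcontfun (T z1) t) (apply_bcontfun (T z2) t)
          = norm (integral {a..?t} (\<lambda>s. A s (apply_bcontfun z1 s) - A s (apply_bcontfun z2 s)))"
        unfolding T P_def dist_norm by (subst Henstock_Kurzweil_Integration.integral_diff[OF int int]) simp
      also have "\<dots> \<le> (K * dist z1 z2) * (?t - a)"
      proof (rule integral_bound[OF ct(1)])
        show "continuous_on {a..?t} (\<lambda>s. A s (apply_bcontfun z1 s) - A s (apply_bcontfun z2 s))"
          using ct by (intro continuous_intros continuous_on_subset[OF contA]) auto
        fix s assume "s \<in> {a..?t}"
        then have s: "s \<in> {a..b}" using ct by auto
        have "norm (A s (apply_bcontfun z1 s) - A s (apply_bcontfun z2 s))
            = norm (A s (apply_bcontfun z1 s - apply_bcontfun z2 s))"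
          using lin[OF s] by (simp add: linear_diff)
        also have "\<dots> \<le> K * norm (apply_bcontfun z1 s - apply_bcontfun z2 s)" by (rule bnd[OF s])
        also have "\<dots> \<le> K * dist z1 z2"
          using K dist_bounded[of z1 s z2] by (intro mult_left_mono) (auto simp: dist_norm)
        finally show "norm (A s (apply_bcontfun z1 s) - A s (apply_bcontfun z2 s)) \<le> K * dist z1 z2" .
      qed
      also have "\<dots> \<le> (K * dist z1 z2) * (b - a)"
        using ct K by (intro mult_left_mono) auto
      finally show "dist (apply_bcontfun (T z1) t) (apply_bcontfun (T z2) t) \<le> K * (b - a) * dist z1 z2"
        by (simp add: mult_ac)
    qed
  qed
  then obtain z where z: "T z = z" by blast
  define y where "y = apply_bcontfun z"
  have yP: "y t = P y t" if "t \<in> {a..b}" for t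
    using T[of z t] cl_id[OF that] z by (simp add: y_def)
  have ycont: "continuous_on {a..b} y" unfolding y_def by simp
  have "(y has_vector_derivative A t (y t)) (at t within {a..b})" if t: "t \<in> {a..b}" for t
  proof -
    have "((\<lambda>t. integral {a..t} (\<lambda>s. A s (y s))) has_vector_derivative A t (y t)) (at t within {a..b})"
      using integral_has_vector_derivative[OF contA[OF ycont] t] .
    then have "(P y has_vector_derivative A t (y t)) (at t within {a..b})"
      unfolding P_def by (auto intro!: derivative_eq_intros)
    then show ?thesis
      by (rule has_vector_derivative_transform[rotated 2]) (use t yP in auto)
  qed
  moreover have "y a = u" using yP[of a] ab by (simp add: P_def)
  ultimately show ?thesis by blast
qed

subsection \<open>Positive definite forms\<close>

definition pos_def_form :: "('a::real_vector \<Rightarrow> 'a \<Rightarrow> real) \<Rightarrow> bool" where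
  "pos_def_form B \<longleftrightarrow>
     (\<forall>y. linear (\<lambda>z. B z y)) \<and> (\<forall>z. linear (B z)) \<and> (\<forall>z. z \<noteq> 0 \<longrightarrow> B z z > 0)"

lemma pos_def_form_eqI:
  assumes B: "pos_def_form B" and eq: "\<And>y. B z y = B z' y"
  shows "z = z'"
proof (rule ccontr)
  assume "z \<noteq> z'"
  then have "B (z - z') (z - z') > 0" using B unfolding pos_def_form_def by simp
  moreover have "linear (\<lambda>v. B v (z - z'))" using B unfolding pos_def_form_def by simp
  then have "B (z - z') (z - z') = B z (z - z') - B z' (z - z')"
    by (rule linear_diff)
  ultimately show False using eq[of "z - z'"] by linarith
qed

text \<open>The Riesz representation for \<open>B\<close>: the map sending \<open>z\<close> to the
  coordinates of \<open>B z\<close> is linear and injective, hence surjective in finite dimension.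
  It makes the definite descriptions behind \<open>christoffel\<close> and \<open>grad\<close>
  meaningful.\<close>

lemma pos_def_form_representation:
  fixes B :: "'a::euclidean_space \<Rightarrow> 'a \<Rightarrow> real"
  assumes B: "pos_def_form B" and l: "linear l"
  shows "\<exists>!z. \<forall>y. B z y = l y"
proof -
  define T where "T z = (\<Sum>b\<in>Basis. B z b *\<^sub>R b)" for z
  have linB: "linear (\<lambda>z. B z y)" "linear (B z)" for y z using B unfolding pos_def_form_def by auto
  have Tb: "T z \<bullet> b = B z b" if "b \<in> Basis" for z b
    unfolding T_def using that by (simp add: inner_sum_left inner_Basis if_distrib cong: if_cong)
  have "linear T"
    by (rule linearI) (simp_all add: T_def linear_add[OF linB(1)] linear_cmul[OF linB(1)]
        scaleR_left_distrib sum.distrib scaleR_sum_right)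
  moreover have "inj T"
  proof (rule injI)
    fix z z' assume "T z = T z'"
    then have "B z b = B z' b" if "b \<in> Basis" for b using Tb[OF that] by metis
    then have "B z y = B z' y" for y
      using linear_functional_expansion[OF linB(2), of z y] linear_functional_expansion[OF linB(2), of z' y] by simp
    then show "z = z'" by (rule pos_def_form_eqI[OF B])
  qed
  ultimately have "surj T" by (rule linear_injective_imp_surjective) simp
  then obtain z where z: "T z = (\<Sum>b\<in>Basis. l b *\<^sub>R b)" by (metis surjD)
  have "B z b = l b" if "b \<in> Basis" for b
    using Tb[OF that, of z] that unfolding z
    by (simp add: inner_sum_left inner_Basis if_distrib cong: if_cong)
  then have "B z y = l y" for y
    using linear_functional_expansion[OF linB(2), of z y] linear_functional_expansion[OF l, of y] by simp
  then show ?thesis using pos_def_form_eqI[OF B] by metis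
qed

text \<open>Compactness of the product of \<open>S\<close> with the unit sphere gives one coercivity
  constant \<open>m\<close> for all \<open>t\<close>. Then m ||z t - z t0||^2 \<le> B t (z t - z t0)
  (z t - z t0), and the right side is a functional with coefficients tending to 0 applied to the
  difference. This yields continuity of the Christoffel symbols without inverting a matrix.\<close>

lemma continuous_on_representation:
  fixes B :: "'t::metric_space \<Rightarrow> 'a::euclidean_space \<Rightarrow> 'a \<Rightarrow> real"
  assumes S: "compact S"
    and B: "\<And>t. t \<in> S \<Longrightarrow> pos_def_form (B t)"
    and contB: "\<And>u w. continuous_on S (\<lambda>t. B t u w)"
    and contl: "\<And>y. continuous_on S (\<lambda>t. l t y)"
    and z: "\<And>t y. t \<in> S \<Longrightarrow> B t (z t) y = l t y"
  shows "continuous_on S z"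
proof -
  have linB: "linear (\<lambda>z. B t z y)" "linear (B t z)" if "t \<in> S" for y z t
    using B[OF that] unfolding pos_def_form_def by auto
  have B_expand: "B t u w = (\<Sum>b\<in>Basis. (w \<bullet> b) * (\<Sum>c\<in>Basis. (u \<bullet> c) * B t c b))" if "t \<in> S" for t u w
    by (subst linear_functional_expansion[OF linB(2)[OF that]], subst linear_functional_expansion[OF linB(1)[OF that]], rule refl)
  obtain m where m: "m > 0" "\<And>t v. t \<in> S \<Longrightarrow> B t v v \<ge> m * (norm v)\<^sup>2"
  proof (cases "S = {}")
    case True
    then show ?thesis using that[of 1] by simp
  next
    case False
    let ?C = "S \<times> sphere (0::'a) 1"
    have comp: "compact ?C" using S by (intro compact_Times) auto
    have "(SOME i. i \<in> Basis) \<in> sphere (0::'a) 1" by (simp add: norm_some_Basis)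
    then have ne: "?C \<noteq> {}" using False by blast
    have "continuous_on ?C (\<lambda>p. \<Sum>b\<in>Basis. (snd p \<bullet> b) * (\<Sum>c\<in>Basis. (snd p \<bullet> c) * B (fst p) c b))"
      by (intro continuous_intros continuous_on_compose2[OF contB]) auto
    then have "continuous_on ?C (\<lambda>p. B (fst p) (snd p) (snd p))"
    proof (rule continuous_on_eq)
      fix p assume "p \<in> ?C"
      then have "fst p \<in> S" by auto
      from B_expand[OF this, of "snd p" "snd p"]
      show "(\<Sum>b\<in>Basis. (snd p \<bullet> b) * (\<Sum>c\<in>Basis. (snd p \<bullet> c) * B (fst p) c b))
        = B (fst p) (snd p) (snd p)" by (rule sym)
    qed
    then obtain p0 where p0: "p0 \<in> ?C"
        "\<And>p. p \<in> ?C \<Longrightarrow> B (fst p0) (snd p0) (snd p0) \<le> B (fst p) (snd p) (snd p)"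
      using continuous_attains_inf[OF comp ne] by blast
    define m where "m = B (fst p0) (snd p0) (snd p0)"
    have "fst p0 \<in> S" "snd p0 \<noteq> 0" using p0(1) by auto
    then have "m > 0" using B[of "fst p0"] unfolding m_def pos_def_form_def by blast
    moreover have "B t v v \<ge> m * (norm v)\<^sup>2" if t: "t \<in> S" for t v
    proof (cases "v = 0")
      case True
      then show ?thesis using linB(2)[OF t] by (simp add: linear_0)
    next
      case False
      let ?w = "(1 / norm v) *\<^sub>R v"
      have "B t v v = B t (norm v *\<^sub>R ?w) (norm v *\<^sub>R ?w)" using False by simp
      also have "\<dots> = (norm v)\<^sup>2 * B t ?w ?w"
        by (subst linear_cmul[OF linB(1)[OF t]], subst linear_cmul[OF linB(2)[OF t]])
          (simp add: power2_eq_square)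
      also have "\<dots> \<ge> (norm v)\<^sup>2 * m"
        using p0(2)[of "(t, ?w)"] t False unfolding m_def by (intro mult_left_mono) auto
      finally show ?thesis by (simp add: mult.commute)
    qed
    ultimately show ?thesis using that by blast
  qed
  show ?thesis
    unfolding continuous_on_def
  proof
    fix t0 assume t0: "t0 \<in> S"
    \<comment> \<open>The residual of the old solution \<open>z t0\<close> in the equation at time
      \<open>t\<close>. It vanishes at \<open>t0\<close>, and for \<open>t\<close> in
      \<open>S\<close> it equals \<open>B t (z t - z t0)\<close>.\<close>
    define r where "r t b = l t b - B t (z t0) b" for t b
    define E where "E t = (\<Sum>b\<in>Basis. \<bar>r t b\<bar>)" for t
    have "((\<lambda>t. r t b) \<longlongrightarrow> r t0 b) (at t0 within S)" for b
      unfolding r_def using contB contl t0 by (intro tendsto_intros) (auto simp: continuous_on_def)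
    moreover have "r t0 b = 0" for b unfolding r_def using z[OF t0] by simp
    ultimately have "(E \<longlongrightarrow> (\<Sum>b\<in>(Basis::'a set). \<bar>0\<bar>)) (at t0 within S)"
      unfolding E_def by (intro tendsto_intros) metis
    then have lim: "((\<lambda>t. E t / m) \<longlongrightarrow> 0) (at t0 within S)"
      using m(1) by (auto intro!: tendsto_eq_intros)
    have est: "norm (z t - z t0) \<le> E t / m" if t: "t \<in> S" for t
    proof -
      let ?d = "z t - z t0"
      have rlin: "linear (r t)"
      proof -
        have "r t = (\<lambda>y. B t ?d y)"
          unfolding r_def by (simp add: z[OF t] linear_diff[OF linB(1)[OF t]])
        then show ?thesis using linB(2)[OF t] by simp
      qed
      have "m * (norm ?d)\<^sup>2 \<le> B t ?d ?d" by (rule m(2)[OF t])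
      also have "\<dots> = r t ?d"
        unfolding r_def by (simp add: z[OF t] linear_diff[OF linB(1)[OF t]])
      also have "\<dots> = (\<Sum>b\<in>Basis. (?d \<bullet> b) * r t b)" by (rule linear_functional_expansion[OF rlin])
      also have "\<dots> \<le> (\<Sum>b\<in>Basis. norm ?d * \<bar>r t b\<bar>)"
      proof (rule sum_mono)
        fix b :: 'a assume "b \<in> Basis"
        have "(?d \<bullet> b) * r t b \<le> \<bar>?d \<bullet> b\<bar> * \<bar>r t b\<bar>" by (metis abs_ge_self abs_mult)
        also have "\<dots> \<le> norm ?d * \<bar>r t b\<bar>"
          using Basis_le_norm[OF \<open>b \<in> Basis\<close>] by (intro mult_right_mono) auto
        finally show "(?d \<bullet> b) * r t b \<le> norm ?d * \<bar>r t b\<bar>" .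
      qed
      also have "\<dots> = norm ?d * E t" by (simp add: E_def sum_distrib_left)
      finally have *: "norm ?d * (m * norm ?d) \<le> norm ?d * E t"
        by (simp add: power2_eq_square mult_ac)
      have "m * norm ?d \<le> E t"
      proof (cases "norm ?d = 0")
        case True
        then show ?thesis by (simp add: E_def sum_nonneg)
      next
        case False
        then show ?thesis using * by (metis less_eq_real_def mult_le_cancel_left_pos norm_ge_zero)
      qed
      then show ?thesis using m(1) by (simp add: field_simps)
    qed
    have "\<forall>\<^sub>F t in at t0 within S. norm (z t - z t0) \<le> E t / m"
      using est by (simp add: eventually_at_filter)
    then have "((\<lambda>t. z t - z t0) \<longlongrightarrow> 0) (at t0 within S)"
      using lim by (rule Lim_null_comparison)
    then show "(z \<longlongrightarrow> z t0) (at t0 within S)" by (rule LIM_zero_cancel)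
  qed
qed

subsection \<open>Charts and tangent vectors\<close>

locale riemannian_mfd =
  fixes M :: "('m::{t2_space, second_countable_topology}, 'e::euclidean_space) riemannian"
  assumes M: "riemannian_manifold M"
begin

definition dtrans :: "('m, 'e) chart \<Rightarrow> ('m, 'e) chart \<Rightarrow> 'm \<Rightarrow> 'e \<Rightarrow> 'e" where
  "dtrans c c' p = frechet_derivative (snd c' \<circ> chart_inv c) (at (snd c p))"

lemma charts_at_iff: "c \<in> charts_at M p \<longleftrightarrow> c \<in> atlas M \<and> p \<in> fst c"
  by (auto simp: charts_at_def)

lemma ex_chart: "\<exists>c. c \<in> charts_at M p"
  using M unfolding riemannian_manifold_def smooth_atlas_def charts_at_def by blast

lemma chart_homeomorphism:
  "c \<in> atlas M \<Longrightarrow> homeomorphism (fst c) (snd c ` fst c) (snd c) (chart_inv c)"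
  using M unfolding riemannian_manifold_def smooth_atlas_def by blast

lemma open_chart: "c \<in> atlas M \<Longrightarrow> open (fst c)"
  using M unfolding riemannian_manifold_def smooth_atlas_def by blast

lemma open_chart_image: "c \<in> atlas M \<Longrightarrow> open (snd c ` fst c)"
  using M unfolding riemannian_manifold_def smooth_atlas_def by blast

lemma chart_inv_chart: "c \<in> atlas M \<Longrightarrow> p \<in> fst c \<Longrightarrow> chart_inv c (snd c p) = p"
  using chart_homeomorphism unfolding homeomorphism_def by blast

lemma chart_continuous: "c \<in> atlas M \<Longrightarrow> continuous_on (fst c) (snd c)"
  using chart_homeomorphism unfolding homeomorphism_def by blast

text \<open>A chart is a homeomorphism onto an open image, so relatively open sets go to open sets.
  Openness is what makes the two-sided derivatives of coordinate changes meaningful and lets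
  functions that agree on the overlap share their derivatives there.\<close>

lemma open_overlap:
  assumes "c \<in> atlas M" "c' \<in> atlas M"
  shows "open (snd c ` (fst c \<inter> fst c'))"
proof -
  have "openin (top_of_set (fst c)) (fst c \<inter> fst c')"
    using open_chart[OF assms(2)] by (simp add: openin_open_Int)
  then have "openin (top_of_set (snd c ` fst c)) (snd c ` (fst c \<inter> fst c'))"
    by (rule homeomorphism_imp_open_map[OF chart_homeomorphism[OF assms(1)]])
  then show ?thesis
    using open_chart_image[OF assms(1)] openin_open_trans by blast
qed

lemma transition_smooth:
  "c \<in> atlas M \<Longrightarrow> c' \<in> atlas M \<Longrightarrow> smooth_on (snd c ` (fst c \<inter> fst c')) (snd c' \<circ> chart_inv c)"
  using M unfolding riemannian_manifold_def smooth_atlas_def by blast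

lemma transition_has_derivative:
  assumes "c \<in> charts_at M p" "c' \<in> charts_at M p"
  shows "((snd c' \<circ> chart_inv c) has_derivative dtrans c c' p) (at (snd c p))"
  unfolding dtrans_def
  by (rule smooth_on_has_derivative[OF transition_smooth]) (use assms in \<open>auto simp: charts_at_iff\<close>)

lemma linear_dtrans:
  "c \<in> charts_at M p \<Longrightarrow> c' \<in> charts_at M p \<Longrightarrow> linear (dtrans c c' p)"
  using transition_has_derivative has_derivative_linear by blast

text \<open>The chain rule: near \<open>snd c p\<close> the composition of the two coordinate
  changes agrees with the direct one. This cocycle identity is what makes \<open>tangent_of\<close>
  produce genuine tangent vectors.\<close>

lemma dtrans_comp:
  assumes c: "c \<in> charts_at M p" "c' \<in> charts_at M p" "c'' \<in> charts_at M p"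
  shows "dtrans c' c'' p (dtrans c c' p u) = dtrans c c'' p u"
proof -
  have at: "c \<in> atlas M" "c' \<in> atlas M" "c'' \<in> atlas M" "p \<in> fst c" "p \<in> fst c'" "p \<in> fst c''"
    using c by (auto simp: charts_at_iff)
  have "(snd c' \<circ> chart_inv c) (snd c p) = snd c' p" using at by (simp add: chart_inv_chart)
  then have "((snd c'' \<circ> chart_inv c') \<circ> (snd c' \<circ> chart_inv c) has_derivative
      (dtrans c' c'' p \<circ> dtrans c c' p)) (at (snd c p))"
    using c by (intro diff_chain_at transition_has_derivative)
      (auto intro: transition_has_derivative)
  then have "((snd c'' \<circ> chart_inv c) has_derivative (dtrans c' c'' p \<circ> dtrans c c' p)) (at (snd c p))"
    by (rule has_derivative_transform_within_open[OF _ open_overlap[of c c']])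
      (use at in \<open>auto simp: chart_inv_chart\<close>)
  then have "dtrans c' c'' p \<circ> dtrans c c' p = dtrans c c'' p"
    using transition_has_derivative[OF c(1,3)] has_derivative_unique by blast
  then show ?thesis by (metis comp_apply)
qed

lemma dtrans_refl:
  assumes c: "c \<in> charts_at M p"
  shows "dtrans c c p u = u"
proof -
  have at: "c \<in> atlas M" "p \<in> fst c" using c by (auto simp: charts_at_iff)
  have "((snd c \<circ> chart_inv c) has_derivative id) (at (snd c p))"
    by (rule has_derivative_transform_within_open[OF has_derivative_id open_chart_image[of c]])
      (use at in \<open>auto simp: chart_inv_chart\<close>)
  then have "dtrans c c p = id"
    using transition_has_derivative[OF c c] has_derivative_unique by blast
  then show ?thesis by simp
qed

lemma dtrans_inverse:
  "c \<in> charts_at M p \<Longrightarrow> c' \<in> charts_at M p \<Longrightarrow> dtrans c c' p (dtrans c' c p u) = u"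
  using dtrans_comp dtrans_refl by metis

lemma tangent_of_apply:
  "tangent_of M c p u c' = (if c' \<in> charts_at M p then dtrans c c' p u else 0)"
  by (simp add: tangent_of_def dtrans_def)

lemma tangent_space_iff:
  "v \<in> tangent_space M p \<longleftrightarrow> (\<forall>c. c \<notin> charts_at M p \<longrightarrow> v c = 0) \<and>
     (\<forall>c\<in>charts_at M p. \<forall>c'\<in>charts_at M p. v c' = dtrans c c' p (v c))"
  by (simp add: tangent_space_def dtrans_def)

lemma tangent_of_in: "c \<in> charts_at M p \<Longrightarrow> tangent_of M c p u \<in> tangent_space M p"
  by (simp add: tangent_space_iff tangent_of_apply dtrans_comp)

lemma tangent_of_self: "c \<in> charts_at M p \<Longrightarrow> tangent_of M c p u c = u"
  by (simp add: tangent_of_apply dtrans_refl)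

lemma tangent_of_component:
  assumes "v \<in> tangent_space M p" "c \<in> charts_at M p"
  shows "tangent_of M c p (v c) = v"
proof
  fix c'
  have "v c' = dtrans c c' p (v c)" if "c' \<in> charts_at M p"
    using assms that unfolding tangent_space_iff by blast
  moreover have "v c' = 0" if "c' \<notin> charts_at M p"
    using assms that unfolding tangent_space_iff by blast
  ultimately show "tangent_of M c p (v c) c' = v c'"
    unfolding tangent_of_apply by (metis (full_types))
qed

lemma tangent_of_combination:
  assumes "c \<in> charts_at M p"
  shows "tangent_of M c p (a *\<^sub>R u + b *\<^sub>R w) =
    (\<lambda>c'. a *\<^sub>R tangent_of M c p u c' + b *\<^sub>R tangent_of M c p w c')"
  using assms by (auto simp: tangent_of_apply linear_add[OF linear_dtrans] linear_cmul[OF linear_dtrans])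

lemma tangent_space_combination:
  assumes "v \<in> tangent_space M p" "w \<in> tangent_space M p"
  shows "(\<lambda>c. a *\<^sub>R v c + b *\<^sub>R w c) \<in> tangent_space M p"
proof -
  have *: "v c' = dtrans c c' p (v c)" "w c' = dtrans c c' p (w c)"
    if "c \<in> charts_at M p" "c' \<in> charts_at M p" for c c'
    using assms that unfolding tangent_space_iff by blast+
  have 1: "a *\<^sub>R v c' + b *\<^sub>R w c' = dtrans c c' p (a *\<^sub>R v c + b *\<^sub>R w c)"
    if "c \<in> charts_at M p" "c' \<in> charts_at M p" for c c'
    using linear_add[OF linear_dtrans[OF that]] linear_cmul[OF linear_dtrans[OF that]] *[OF that] by simp
  have "v c = 0" "w c = 0" if "c \<notin> charts_at M p" for c
    using assms that unfolding tangent_space_iff by blast+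
  then have 2: "a *\<^sub>R v c + b *\<^sub>R w c = 0" if "c \<notin> charts_at M p" for c
    using that by simp
  show ?thesis unfolding tangent_space_iff by (intro conjI allI impI ballI 1 2)
qed

lemma tangent_space_scaleR:
  "v \<in> tangent_space M p \<Longrightarrow> (\<lambda>c. a *\<^sub>R v c) \<in> tangent_space M p"
  using tangent_space_combination[of v p v a 0] by simp

lemma tangent_space_diff:
  "v \<in> tangent_space M p \<Longrightarrow> w \<in> tangent_space M p \<Longrightarrow> v - w \<in> tangent_space M p"
  using tangent_space_combination[of v p w 1 "-1"] by (simp add: fun_diff_def)

section \<open>Inner product and norm on a tangent space\<close>

lemma metric_sym:
  "u \<in> tangent_space M p \<Longrightarrow> v \<in> tangent_space M p \<Longrightarrow> metric M p u v = metric M p v u"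
  using M unfolding riemannian_manifold_def by blast

lemma metric_combination:
  "u \<in> tangent_space M p \<Longrightarrow> v \<in> tangent_space M p \<Longrightarrow> w \<in> tangent_space M p \<Longrightarrow>
    metric M p (\<lambda>c. a *\<^sub>R u c + b *\<^sub>R v c) w = a * metric M p u w + b * metric M p v w"
  using M unfolding riemannian_manifold_def by blast

lemma metric_pos: "v \<in> tangent_space M p \<Longrightarrow> v \<noteq> (\<lambda>_. 0) \<Longrightarrow> metric M p v v > 0"
  using M unfolding riemannian_manifold_def by blast

lemma metric_scaleR:
  "u \<in> tangent_space M p \<Longrightarrow> w \<in> tangent_space M p \<Longrightarrow>
    metric M p (\<lambda>c. a *\<^sub>R u c) w = a * metric M p u w"
  using metric_combination[of u p u w a 0] by simp

lemma metric_diff: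
  "u \<in> tangent_space M p \<Longrightarrow> v \<in> tangent_space M p \<Longrightarrow> w \<in> tangent_space M p \<Longrightarrow>
    metric M p (u - v) w = metric M p u w - metric M p v w"
  using metric_combination[of u p v w 1 "-1"] by (simp add: fun_diff_def)

lemma metric_nonneg: "v \<in> tangent_space M p \<Longrightarrow> metric M p v v \<ge> 0"
  using metric_pos[of v p] metric_scaleR[of v p v 0] by fastforce

lemma tnorm_nonneg: "v \<in> tangent_space M p \<Longrightarrow> tnorm M p v \<ge> 0"
  by (simp add: tnorm_def metric_nonneg)

lemma tnorm_pos: "v \<in> tangent_space M p \<Longrightarrow> v \<noteq> (\<lambda>_. 0) \<Longrightarrow> tnorm M p v > 0"
  by (simp add: tnorm_def metric_pos)

lemma tnorm_power2: "v \<in> tangent_space M p \<Longrightarrow> (tnorm M p v)\<^sup>2 = metric M p v v"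
  by (simp add: tnorm_def metric_nonneg)

text \<open>Expanding the squared norm of ||w|| v - ||v|| w gives 2 ||v|| ||w|| (||v|| ||w|| - <v,
  w>), which is nonnegative; the cases of a zero vector are separate because the prefactor vanishes
  there.\<close>

lemma metric_Cauchy_Schwarz:
  assumes v: "v \<in> tangent_space M p" and w: "w \<in> tangent_space M p"
  shows "metric M p v w \<le> tnorm M p v * tnorm M p w"
proof (cases "w = (\<lambda>_. 0)")
  case True
  then have "metric M p w v = 0" using metric_scaleR[OF w v, of 0] by simp
  then show ?thesis using metric_sym[OF v w] tnorm_nonneg[OF v] tnorm_nonneg[OF w] by simp
next
  case False
  let ?a = "tnorm M p w" and ?b = "tnorm M p v"
  have pos: "?a > 0" by (rule tnorm_pos[OF w False])
  let ?z = "\<lambda>c. ?a *\<^sub>R v c + (- ?b) *\<^sub>R w c"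
  have z: "?z \<in> tangent_space M p" by (rule tangent_space_combination[OF v w])
  have zv: "metric M p ?z v = ?a * ?b\<^sup>2 - ?b * metric M p v w"
    unfolding metric_combination[OF v w v] tnorm_power2[OF v] metric_sym[OF w v] by simp
  have zw: "metric M p ?z w = ?a * metric M p v w - ?b * ?a\<^sup>2"
    unfolding metric_combination[OF v w w] tnorm_power2[OF w] by simp
  have "0 \<le> metric M p ?z ?z" by (rule metric_nonneg[OF z])
  also have "\<dots> = ?a * metric M p ?z v - ?b * metric M p ?z w"
    unfolding metric_combination[OF v w z] metric_sym[OF v z] metric_sym[OF w z] by simp
  also have "\<dots> = (2 * ?a * ?b) * (?a * ?b - metric M p v w)"
    unfolding zv zw by (simp add: algebra_simps power2_eq_square)
  finally have *: "0 \<le> (2 * ?a * ?b) * (?a * ?b - metric M p v w)" .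
  show ?thesis
  proof (cases "?b = 0")
    case True
    then have "v = (\<lambda>_. 0)" using tnorm_pos[OF v] by fastforce
    then have "metric M p v w = 0" using metric_scaleR[OF v w, of 0] by simp
    then show ?thesis using True by simp
  next
    case False
    then have "2 * ?a * ?b > 0" using tnorm_nonneg[OF v] pos by simp
    then show ?thesis using * by (simp add: zero_le_mult_iff mult.commute)
  qed
qed

section \<open>The metric in coordinates\<close>

lemma local_metric_at:
  "c \<in> charts_at M p \<Longrightarrow>
    local_metric M c (snd c p) u w = metric M p (tangent_of M c p u) (tangent_of M c p w)"
  by (simp add: local_metric_def charts_at_iff chart_inv_chart)

lemma metric_eq_local_metric:
  "c \<in> charts_at M p \<Longrightarrow> v \<in> tangent_space M p \<Longrightarrow> w \<in> tangent_space M p \<Longrightarrow>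
    metric M p v w = local_metric M c (snd c p) (v c) (w c)"
  by (simp add: local_metric_at tangent_of_component)

lemma local_metric_sym:
  assumes "c \<in> atlas M" "x \<in> snd c ` fst c"
  shows "local_metric M c x u w = local_metric M c x w u"
proof -
  obtain p where "c \<in> charts_at M p" "x = snd c p" using assms by (auto simp: charts_at_iff)
  then show ?thesis by (simp add: local_metric_at metric_sym tangent_of_in)
qed

lemma local_metric_pos_def:
  assumes "c \<in> atlas M" "x \<in> snd c ` fst c"
  shows "pos_def_form (local_metric M c x)"
proof -
  obtain p where p: "c \<in> charts_at M p" "x = snd c p" using assms by (auto simp: charts_at_iff)
  let ?g = "local_metric M c x"
  have comb: "?g (a *\<^sub>R u + b *\<^sub>R u') w = a * ?g u w + b * ?g u' w" for a b u u' w
    using p by (simp add: local_metric_at tangent_of_combination metric_combination tangent_of_in)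
  have l: "linear (\<lambda>u. ?g u w)" for w
    using comb[of 1 _ 1 _ w] comb[of _ _ 0 _ w] by (intro linearI) simp_all
  have "?g u = (\<lambda>w. ?g w u)" for u using local_metric_sym[OF assms] by blast
  then have r: "linear (?g u)" for u using l[of u] by metis
  have "?g u u > 0" if "u \<noteq> 0" for u
  proof -
    have "tangent_of M c p u \<noteq> (\<lambda>_. 0)" using that tangent_of_self[OF p(1), of u] by auto
    then show ?thesis using p by (simp add: local_metric_at metric_pos tangent_of_in)
  qed
  then show ?thesis unfolding pos_def_form_def using l r by blast
qed

lemma linear_local_metric:
  assumes "c \<in> atlas M" "x \<in> snd c ` fst c"
  shows linear_local_metric1: "linear (\<lambda>u. local_metric M c x u w)"
    and linear_local_metric2: "linear (local_metric M c x w)"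
  using local_metric_pos_def[OF assms] unfolding pos_def_form_def by simp_all

lemma local_metric_change:
  assumes c: "c \<in> charts_at M p" "c' \<in> charts_at M p"
  shows "local_metric M c (snd c p) u w =
    local_metric M c' (snd c' p) (dtrans c c' p u) (dtrans c c' p w)"
proof -
  have "tangent_of M c p u = tangent_of M c' p (dtrans c c' p u)" for u
    using tangent_of_component[OF tangent_of_in[OF c(1)] c(2), of u] c
    by (simp add: tangent_of_apply)
  then show ?thesis using c by (simp add: local_metric_at)
qed

subsection \<open>The Levi-Civita connection in coordinates\<close>

text \<open>The argument \<open>a\<close> is the direction of differentiation; \<open>u\<close> and
  \<open>w\<close> are the arguments of the metric.\<close>

definition dmetric :: "('m, 'e) chart \<Rightarrow> 'e \<Rightarrow> 'e \<Rightarrow> 'e \<Rightarrow> 'e \<Rightarrow> real" where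
  "dmetric c x a u w = frechet_derivative (\<lambda>x. local_metric M c x u w) (at x) a"

lemma local_metric_smooth:
  "c \<in> atlas M \<Longrightarrow> smooth_on (snd c ` fst c) (\<lambda>x. local_metric M c x u w)"
  using M unfolding riemannian_manifold_def by blast

lemma local_metric_has_derivative:
  "c \<in> atlas M \<Longrightarrow> x \<in> snd c ` fst c \<Longrightarrow>
    ((\<lambda>x. local_metric M c x u w) has_derivative (\<lambda>a. dmetric c x a u w)) (at x)"
  unfolding dmetric_def using smooth_on_has_derivative[OF local_metric_smooth] by blast

lemma continuous_on_dmetric: "c \<in> atlas M \<Longrightarrow> continuous_on (snd c ` fst c) (\<lambda>x. dmetric c x a u w)"
  unfolding dmetric_def
  by (intro smooth_on_continuous smooth_on_frechet_derivative local_metric_smooth)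

text \<open>Linearity in \<open>a\<close> is that of a derivative. For \<open>u\<close> and
  \<open>w\<close> it is inherited from the metric by uniqueness of derivatives; the metric is known
  to be bilinear only over the chart image, so functions are compared on that open set.\<close>

lemma dmetric_linear:
  assumes c: "c \<in> atlas M" and x: "x \<in> snd c ` fst c"
  shows dmetric_linear1: "linear (\<lambda>a. dmetric c x a u w)"
    and dmetric_linear2: "linear (\<lambda>u. dmetric c x a u w)"
    and dmetric_linear3: "linear (\<lambda>w. dmetric c x a u w)"
proof -
  note d = local_metric_has_derivative[OF c x]
  show "linear (\<lambda>a. dmetric c x a u w)" using d has_derivative_linear by blast
  have eqI: "dmetric c x a u w = f a"
    if "(g has_derivative f) (at x)" "\<And>y. y \<in> snd c ` fst c \<Longrightarrow> g y = local_metric M c y u w" for f g a u w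
    using has_derivative_transform_within_open[OF that(1) open_chart_image[OF c] x that(2)] d[of u w]
      has_derivative_unique by metis
  show "linear (\<lambda>u. dmetric c x a u w)"
  proof (rule linearI)
    show "dmetric c x a (u + u') w = dmetric c x a u w + dmetric c x a u' w" for u u'
      by (rule eqI[OF has_derivative_add[OF d d]])
        (simp add: linear_add[OF linear_local_metric1[OF c]])
    show "dmetric c x a (r *\<^sub>R u) w = r *\<^sub>R dmetric c x a u w" for r u
      by (rule eqI[OF has_derivative_scaleR_right[OF d]])
        (simp add: linear_cmul[OF linear_local_metric1[OF c]])
  qed
  show "linear (\<lambda>w. dmetric c x a u w)"
  proof (rule linearI)
    show "dmetric c x a u (w + w') = dmetric c x a u w + dmetric c x a u w'" for w w'
      by (rule eqI[OF has_derivative_add[OF d d]])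
        (simp add: linear_add[OF linear_local_metric2[OF c]])
    show "dmetric c x a u (r *\<^sub>R w) = r *\<^sub>R dmetric c x a u w" for r w
      by (rule eqI[OF has_derivative_scaleR_right[OF d]])
        (simp add: linear_cmul[OF linear_local_metric2[OF c]])
  qed
qed

lemma dmetric_sym:
  assumes c: "c \<in> atlas M" and x: "x \<in> snd c ` fst c"
  shows "dmetric c x a u w = dmetric c x a w u"
proof -
  have "((\<lambda>x. local_metric M c x u w) has_derivative (\<lambda>a. dmetric c x a w u)) (at x)"
    by (rule has_derivative_transform_within_open[OF local_metric_has_derivative[OF c x]
        open_chart_image[OF c] x local_metric_sym[OF c]])
  then show ?thesis
    using local_metric_has_derivative[OF c x, of u w] has_derivative_unique by metis
qed

text \<open>Half of the right side is linear in \<open>y\<close>, so the positive definite metric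
  represents it by exactly one vector. The first conclusion evaluates the definite description, the
  second recognizes its value.\<close>

lemma Koszul:
  assumes c: "c \<in> atlas M" and x: "x \<in> snd c ` fst c"
  shows "2 * local_metric M c x (christoffel M c x u w) y =
    dmetric c x u w y + dmetric c x w u y - dmetric c x y u w"
    and christoffel_eqI: "(\<And>y. 2 * local_metric M c x z y =
      dmetric c x u w y + dmetric c x w u y - dmetric c x y u w) \<Longrightarrow> christoffel M c x u w = z"
proof -
  let ?l = "\<lambda>y. (dmetric c x u w y + dmetric c x w u y - dmetric c x y u w) / 2"
  have "linear ?l"
    by (intro linearI) (simp_all add: linear_add[OF dmetric_linear1[OF c x]]
        linear_cmul[OF dmetric_linear1[OF c x]] linear_add[OF dmetric_linear3[OF c x]]
        linear_cmul[OF dmetric_linear3[OF c x]] field_simps)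
  then have "\<exists>!z. \<forall>y. local_metric M c x z y = ?l y"
    by (rule pos_def_form_representation[OF local_metric_pos_def[OF c x]])
  then have ex: "\<exists>!z. \<forall>y. 2 * local_metric M c x z y =
      dmetric c x u w y + dmetric c x w u y - dmetric c x y u w"
    by (simp add: field_simps)
  have eq: "christoffel M c x u w = (THE z. \<forall>y. 2 * local_metric M c x z y =
      dmetric c x u w y + dmetric c x w u y - dmetric c x y u w)"
    by (simp add: christoffel_def dmetric_def)
  show "2 * local_metric M c x (christoffel M c x u w) y =
    dmetric c x u w y + dmetric c x w u y - dmetric c x y u w"
    using theI'[OF ex] unfolding eq by blast
  show "christoffel M c x u w = z" if "\<And>y. 2 * local_metric M c x z y =
      dmetric c x u w y + dmetric c x w u y - dmetric c x y u w"
    unfolding eq using ex that by (intro the1_equality) auto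
qed

text \<open>Linearity in the transported vector is what makes the parallel equation a linear
  differential equation.\<close>

lemma linear_christoffel:
  assumes c: "c \<in> atlas M" and x: "x \<in> snd c ` fst c"
  shows "linear (christoffel M c x u)"
proof (rule linearI)
  note lin = linear_add[OF linear_local_metric1[OF c x]] linear_cmul[OF linear_local_metric1[OF c x]]
    linear_add[OF dmetric_linear1[OF c x]] linear_cmul[OF dmetric_linear1[OF c x]]
    linear_add[OF dmetric_linear2[OF c x]] linear_cmul[OF dmetric_linear2[OF c x]]
    linear_add[OF dmetric_linear3[OF c x]] linear_cmul[OF dmetric_linear3[OF c x]]
  show "christoffel M c x u (w + w') = christoffel M c x u w + christoffel M c x u w'" for w w'
    by (rule christoffel_eqI[OF c x]) (simp add: lin distrib_left Koszul[OF c x])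
  show "christoffel M c x u (r *\<^sub>R w) = r *\<^sub>R christoffel M c x u w" for r w
  proof (rule christoffel_eqI[OF c x])
    fix y
    have "2 * local_metric M c x (r *\<^sub>R christoffel M c x u w) y
        = r * (2 * local_metric M c x (christoffel M c x u w) y)" by (simp add: lin)
    then show "2 * local_metric M c x (r *\<^sub>R christoffel M c x u w) y =
        dmetric c x u (r *\<^sub>R w) y + dmetric c x (r *\<^sub>R w) u y - dmetric c x y u (r *\<^sub>R w)"
      unfolding Koszul[OF c x] by (simp add: lin algebra_simps)
  qed
qed

text \<open>The product rule, obtained by applying \<open>has_derivative_linear_family\<close>
  twice: to the second slot with the first one frozen, then to the first slot. The source is a
  general normed space because the lemma serves both curves, with a real parameter, and coordinate
  changes, with a point of the model space.\<close>

lemma local_metric_compose_has_derivative: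
  fixes \<xi> u w :: "'s::real_normed_vector \<Rightarrow> 'e"
  assumes c: "c \<in> atlas M" and x: "\<xi> t \<in> snd c ` fst c" and t: "t \<in> I"
    and \<xi>: "(\<xi> has_derivative \<xi>') (at t within I)"
    and u: "(u has_derivative u') (at t within I)"
    and w: "(w has_derivative w') (at t within I)"
  shows "((\<lambda>s. local_metric M c (\<xi> s) (u s) (w s)) has_derivative
    (\<lambda>h. dmetric c (\<xi> t) (\<xi>' h) (u t) (w t) + local_metric M c (\<xi> t) (u t) (w' h)
      + local_metric M c (\<xi> t) (u' h) (w t))) (at t within I)"
proof -
  have ev: "\<forall>\<^sub>F s in at t within I. \<xi> s \<in> snd c ` fst c"
    using has_derivative_continuous[OF \<xi>] open_chart_image[OF c] x
    by (auto simp: continuous_within dest: topological_tendstoD)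
  have "((\<lambda>s. local_metric M c (\<xi> s) p q) has_derivative (\<lambda>h. dmetric c (\<xi> t) (\<xi>' h) p q))
      (at t within I)" for p q
    by (rule has_derivative_compose[OF \<xi> local_metric_has_derivative[OF c x]])
  then have "((\<lambda>s. local_metric M c (\<xi> s) p (w s)) has_derivative
      (\<lambda>h. dmetric c (\<xi> t) (\<xi>' h) p (w t) + local_metric M c (\<xi> t) p (w' h))) (at t within I)" for p
    using ev linear_local_metric2[OF c] x
    by (intro has_derivative_linear_family[where D = "\<lambda>q h. dmetric c (\<xi> t) (\<xi>' h) p q", OF t _ _ _ w])
      (auto elim!: eventually_mono)
  then show ?thesis
    using ev linear_local_metric1[OF c] x
    by (intro has_derivative_linear_family[where F = "\<lambda>s p. local_metric M c (\<xi> s) p (w s)"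
          and D = "\<lambda>p h. dmetric c (\<xi> t) (\<xi>' h) p (w t) + local_metric M c (\<xi> t) p (w' h)", OF t _ _ _ u])
      (auto elim!: eventually_mono)
qed

section \<open>Second derivatives of coordinate changes and the Christoffel symbols\<close>

text \<open>The second derivative of the coordinate change, first along \<open>u\<close> and then
  along \<open>w\<close>: the inhomogeneous term by which Christoffel symbols fail to be a
  tensor.\<close>

definition d2trans :: "('m, 'e) chart \<Rightarrow> ('m, 'e) chart \<Rightarrow> 'm \<Rightarrow> 'e \<Rightarrow> 'e \<Rightarrow> 'e" where
  "d2trans c c' p u w =
     frechet_derivative (\<lambda>x. frechet_derivative (snd c' \<circ> chart_inv c) (at x) u) (at (snd c p)) w"

lemma d2trans_has_derivative:
  assumes "c \<in> charts_at M p" "c' \<in> charts_at M p"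
  shows "((\<lambda>x. frechet_derivative (snd c' \<circ> chart_inv c) (at x) u) has_derivative d2trans c c' p u)
    (at (snd c p))"
  unfolding d2trans_def
  by (rule smooth_on_has_derivative[OF smooth_on_frechet_derivative[OF transition_smooth]])
    (use assms in \<open>auto simp: charts_at_iff\<close>)

lemma d2trans_sym:
  assumes "c \<in> charts_at M p" "c' \<in> charts_at M p"
  shows "d2trans c c' p u w = d2trans c c' p w u"
  unfolding d2trans_def
  by (rule symmetric_second_derivative[OF open_overlap _ transition_smooth])
    (use assms in \<open>auto simp: charts_at_iff\<close>)

text \<open>Differentiate along \<open>a\<close> the relation expressing the metric in
  \<open>c\<close> through the metric in \<open>c'\<close>. Besides the base point, both arguments
  move, since the derivative of the coordinate change depends on the point; this produces the two
  second-derivative terms.\<close>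

lemma dmetric_change:
  assumes c: "c \<in> charts_at M p" "c' \<in> charts_at M p"
  defines "T \<equiv> dtrans c c' p" and "g' \<equiv> local_metric M c' (snd c' p)"
  shows "dmetric c (snd c p) a u w = dmetric c' (snd c' p) (T a) (T u) (T w)
    + g' (T u) (d2trans c c' p w a) + g' (d2trans c c' p u a) (T w)"
proof -
  let ?\<phi> = "snd c' \<circ> chart_inv c"
  have at: "c \<in> atlas M" "c' \<in> atlas M" "p \<in> fst c" "p \<in> fst c'" using c by (auto simp: charts_at_iff)
  have \<phi>p: "?\<phi> (snd c p) = snd c' p" using at by (simp add: chart_inv_chart)
  have D: "frechet_derivative ?\<phi> (at (snd c p)) = T" by (simp add: T_def dtrans_def)
  have "((\<lambda>x. local_metric M c' (?\<phi> x) (frechet_derivative ?\<phi> (at x) u) (frechet_derivative ?\<phi> (at x) w))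
    has_derivative (\<lambda>a. dmetric c' (?\<phi> (snd c p)) (T a) (frechet_derivative ?\<phi> (at (snd c p)) u)
        (frechet_derivative ?\<phi> (at (snd c p)) w)
      + local_metric M c' (?\<phi> (snd c p)) (frechet_derivative ?\<phi> (at (snd c p)) u) (d2trans c c' p w a)
      + local_metric M c' (?\<phi> (snd c p)) (d2trans c c' p u a) (frechet_derivative ?\<phi> (at (snd c p)) w)))
    (at (snd c p))"
  proof (rule local_metric_compose_has_derivative[OF at(2) _ UNIV_I])
    show "?\<phi> (snd c p) \<in> snd c' ` fst c'" unfolding \<phi>p using at(4) by (rule imageI)
    show "(?\<phi> has_derivative T) (at (snd c p))"
      unfolding T_def by (rule transition_has_derivative[OF c])
    show "((\<lambda>x. frechet_derivative ?\<phi> (at x) u) has_derivative d2trans c c' p u) (at (snd c p))"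
      by (rule d2trans_has_derivative[OF c])
    show "((\<lambda>x. frechet_derivative ?\<phi> (at x) w) has_derivative d2trans c c' p w) (at (snd c p))"
      by (rule d2trans_has_derivative[OF c])
  qed
  then have "((\<lambda>x. local_metric M c x u w) has_derivative
      (\<lambda>a. dmetric c' (snd c' p) (T a) (T u) (T w)
        + g' (T u) (d2trans c c' p w a) + g' (d2trans c c' p u a) (T w))) (at (snd c p))"
    unfolding \<phi>p D g'_def
  proof (rule has_derivative_transform_within_open[OF _ open_overlap[OF at(1,2)]])
    show "snd c p \<in> snd c ` (fst c \<inter> fst c')" using at by blast
    fix x assume "x \<in> snd c ` (fst c \<inter> fst c')"
    then obtain q where q: "x = snd c q" "c \<in> charts_at M q" "c' \<in> charts_at M q"
      using at by (auto simp: charts_at_iff)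
    then have "?\<phi> x = snd c' q" by (simp add: chart_inv_chart charts_at_iff)
    then show "local_metric M c' (?\<phi> x) (frechet_derivative ?\<phi> (at x) u) (frechet_derivative ?\<phi> (at x) w)
        = local_metric M c x u w"
      using local_metric_change[OF q(2,3), of u w] by (simp add: dtrans_def q(1))
  qed
  moreover have "((\<lambda>x. local_metric M c x u w) has_derivative (\<lambda>a. dmetric c (snd c p) a u w))
      (at (snd c p))"
    using at by (intro local_metric_has_derivative) auto
  ultimately have "(\<lambda>a. dmetric c' (snd c' p) (T a) (T u) (T w)
        + g' (T u) (d2trans c c' p w a) + g' (d2trans c c' p u a) (T w))
      = (\<lambda>a. dmetric c (snd c p) a u w)" by (rule has_derivative_unique)
  then show ?thesis by (rule fun_cong[symmetric])
qed

text \<open>Inserting \<open>dmetric_change\<close> into Koszul's formula creates six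
  second-derivative terms. By symmetry of the metric and of \<open>d2trans\<close> four of them
  cancel, and the remaining two coincide, which matches the factor 2 of the formula.\<close>

lemma christoffel_change:
  assumes c: "c \<in> charts_at M p" "c' \<in> charts_at M p"
  defines "T \<equiv> dtrans c c' p"
  shows "T (christoffel M c (snd c p) u w) =
    christoffel M c' (snd c' p) (T u) (T w) + d2trans c c' p u w"
proof -
  let ?g' = "local_metric M c' (snd c' p)" and ?H = "d2trans c c' p"
    and ?G = "christoffel M c (snd c p) u w" and ?G' = "christoffel M c' (snd c' p) (T u) (T w)"
  have at: "c \<in> atlas M" "c' \<in> atlas M" and p: "snd c p \<in> snd c ` fst c" "snd c' p \<in> snd c' ` fst c'"
    using c by (auto simp: charts_at_iff)
  note sym = local_metric_sym[OF at(2) p(2)] d2trans_sym[OF c]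
  show ?thesis
  proof (rule pos_def_form_eqI[OF local_metric_pos_def[OF at(2) p(2)]])
    fix y'
    \<comment> \<open>The derivative of the coordinate change is invertible, so every test vector in
      \<open>c'\<close> comes from one in \<open>c\<close>, where Koszul's formula is
      applied.\<close>
    define y where "y = dtrans c' c p y'"
    have y': "y' = T y" unfolding y_def T_def using dtrans_inverse[OF c] by simp
    have "2 * ?g' (T ?G) (T y) = 2 * local_metric M c (snd c p) ?G y"
      using local_metric_change[OF c] by (simp add: T_def)
    also have "\<dots> = dmetric c (snd c p) u w y + dmetric c (snd c p) w u y - dmetric c (snd c p) y u w"
      by (rule Koszul[OF at(1) p(1)])
    also have "\<dots> = (dmetric c' (snd c' p) (T u) (T w) (T y) + dmetric c' (snd c' p) (T w) (T u) (T y)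
          - dmetric c' (snd c' p) (T y) (T u) (T w)) + 2 * ?g' (?H u w) (T y)"
      unfolding dmetric_change[OF c, folded T_def]
      using sym(1)[of "T w" "?H y u"] sym(1)[of "T u" "?H y w"] sym(1)[of "T w" "?H u y"]
        sym(2)[of w u] sym(2)[of y u] sym(2)[of y w] by simp
    also have "\<dots> = 2 * ?g' (?G' + ?H u w) (T y)"
      using Koszul[OF at(2) p(2), of "T u" "T w" "T y"]
      by (simp add: linear_add[OF linear_local_metric1[OF at(2) p(2)]])
    finally show "?g' (T ?G) y' = ?g' (?G' + ?H u w) y'" unfolding y' by simp
  qed
qed

subsection \<open>Parallel fields along curves\<close>

lemma eventually_in_chart:
  assumes "continuous_on I \<gamma>" "t \<in> I" "c \<in> charts_at M (\<gamma> t)"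
  shows "\<forall>\<^sub>F s in at t within I. c \<in> charts_at M (\<gamma> s)"
proof -
  have "(\<gamma> \<longlongrightarrow> \<gamma> t) (at t within I)" using assms by (simp add: continuous_on_def)
  then have "\<forall>\<^sub>F s in at t within I. \<gamma> s \<in> fst c"
    using assms open_chart[of c] by (auto simp: charts_at_iff dest: topological_tendstoD)
  then show ?thesis using assms(3) by (auto simp: charts_at_iff)
qed

lemma velocity_has_vector_derivative:
  assumes "differentiable_curve_on M I \<gamma>" "t \<in> I" "c \<in> charts_at M (\<gamma> t)"
  shows "((snd c \<circ> \<gamma>) has_vector_derivative velocity M I \<gamma> t c) (at t within I)"
  using assms unfolding differentiable_curve_on_def velocity_def
  by (simp add: vector_derivative_works)

lemma has_vector_derivative_change_chart:
  assumes \<gamma>: "continuous_on I \<gamma>" "t \<in> I" and c: "c \<in> charts_at M (\<gamma> t)" "c' \<in> charts_at M (\<gamma> t)"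
    and d: "((snd c \<circ> \<gamma>) has_vector_derivative v) (at t within I)"
  shows "((snd c' \<circ> \<gamma>) has_vector_derivative dtrans c c' (\<gamma> t) v) (at t within I)"
proof -
  have "((\<lambda>s. (snd c' \<circ> chart_inv c) ((snd c \<circ> \<gamma>) s)) has_derivative
      (\<lambda>h. dtrans c c' (\<gamma> t) (h *\<^sub>R v))) (at t within I)"
    using d transition_has_derivative[OF c] unfolding has_vector_derivative_def comp_apply[of "snd c" \<gamma> t, symmetric]
    by (rule has_derivative_compose)
  moreover have "\<forall>\<^sub>F s in at t within I. (snd c' \<circ> chart_inv c) ((snd c \<circ> \<gamma>) s) = (snd c' \<circ> \<gamma>) s"
    using eventually_in_chart[OF \<gamma> c(1)] by eventually_elim (simp add: charts_at_iff chart_inv_chart)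
  ultimately have "((snd c' \<circ> \<gamma>) has_derivative (\<lambda>h. dtrans c c' (\<gamma> t) (h *\<^sub>R v))) (at t within I)"
    by (rule has_derivative_transform_eventually) (use \<gamma> c in \<open>simp_all add: charts_at_iff chart_inv_chart\<close>)
  then show ?thesis
    unfolding has_vector_derivative_def by (simp add: linear_cmul[OF linear_dtrans[OF c]])
qed

text \<open>The chain rule gives a derivative in \<open>c'\<close>; it is the one named by
  \<open>velocity\<close> because derivatives are unique at a point that is not isolated in
  \<open>I\<close>.\<close>

lemma velocity_in_tangent_space:
  assumes \<gamma>: "differentiable_curve_on M I \<gamma>" and t: "t \<in> I" "at t within I \<noteq> bot"
  shows "velocity M I \<gamma> t \<in> tangent_space M (\<gamma> t)"
  unfolding tangent_space_iff
proof (intro conjI allI impI ballI)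
  fix c c' assume c: "c \<in> charts_at M (\<gamma> t)" "c' \<in> charts_at M (\<gamma> t)"
  have "continuous_on I \<gamma>" using \<gamma> by (simp add: differentiable_curve_on_def)
  from has_vector_derivative_change_chart[OF this t(1) c velocity_has_vector_derivative[OF \<gamma> t(1) c(1)]]
  show "velocity M I \<gamma> t c' = dtrans c c' (\<gamma> t) (velocity M I \<gamma> t c)"
    using velocity_has_vector_derivative[OF \<gamma> t(1) c(2)] t(2) vector_derivative_within by metis
qed (simp add: velocity_def)

text \<open>Metric compatibility of the connection. Adding Koszul's formula for the velocity,
  \<open>V\<close>, \<open>W\<close> to the one with \<open>V\<close> and \<open>W\<close> exchanged
  leaves twice the derivative of the metric along the velocity; this is exactly what the two
  Christoffel terms in the derivatives of \<open>V\<close> and \<open>W\<close> cancel.\<close>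

lemma parallel_metric_has_derivative_zero:
  assumes \<gamma>: "differentiable_curve_on M I \<gamma>" and t: "t \<in> I"
    and V: "parallel_on M I \<gamma> V" and W: "parallel_on M I \<gamma> W"
  shows "((\<lambda>s. metric M (\<gamma> s) (V s) (W s)) has_derivative (\<lambda>h. 0)) (at t within I)"
proof -
  obtain c where c: "c \<in> charts_at M (\<gamma> t)" using ex_chart by blast
  have at: "c \<in> atlas M" and x: "snd c (\<gamma> t) \<in> snd c ` fst c" using c by (auto simp: charts_at_iff)
  let ?x = "snd c (\<gamma> t)" and ?v = "velocity M I \<gamma> t c" and ?g = "local_metric M c (snd c (\<gamma> t))"
  let ?G = "christoffel M c ?x ?v"
  note lin = linear_cmul[OF dmetric_linear1[OF at x]]
    linear_cmul[OF linear_local_metric1[OF at x]] linear_cmul[OF linear_local_metric2[OF at x]]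
    linear_neg[OF linear_local_metric1[OF at x]] linear_neg[OF linear_local_metric2[OF at x]]
  have par: "((\<lambda>s. U s c) has_derivative (\<lambda>h. h *\<^sub>R - ?G (U t c))) (at t within I)"
    if "parallel_on M I \<gamma> U" for U
    using that t c unfolding parallel_on_def has_vector_derivative_def by blast
  have ev: "\<forall>\<^sub>F s in at t within I. c \<in> charts_at M (\<gamma> s)"
    using eventually_in_chart \<gamma> t c unfolding differentiable_curve_on_def by blast
  have tan: "V s \<in> tangent_space M (\<gamma> s)" "W s \<in> tangent_space M (\<gamma> s)" if "s \<in> I" for s
    using that V W unfolding parallel_on_def by blast+
  have "?g (V t c) (?G (W t c)) + ?g (?G (V t c)) (W t c) = dmetric c ?x ?v (V t c) (W t c)"
    using Koszul[OF at x, of ?v "V t c" "W t c"] Koszul[OF at x, of ?v "W t c" "V t c"]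
      local_metric_sym[OF at x, of "V t c" "?G (W t c)"] dmetric_sym[OF at x] by simp
  then have zero: "dmetric c ?x (h *\<^sub>R ?v) (V t c) (W t c) + ?g (V t c) (h *\<^sub>R - ?G (W t c))
      + ?g (h *\<^sub>R - ?G (V t c)) (W t c) = 0" for h
    by (simp only: lin) (simp add: algebra_simps flip: distrib_left)
  have "((\<lambda>s. local_metric M c ((snd c \<circ> \<gamma>) s) (V s c) (W s c)) has_derivative
      (\<lambda>h. dmetric c ((snd c \<circ> \<gamma>) t) (h *\<^sub>R ?v) (V t c) (W t c)
        + local_metric M c ((snd c \<circ> \<gamma>) t) (V t c) (h *\<^sub>R - ?G (W t c))
        + local_metric M c ((snd c \<circ> \<gamma>) t) (h *\<^sub>R - ?G (V t c)) (W t c))) (at t within I)"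
    by (rule local_metric_compose_has_derivative[OF at _ t _ par[OF V] par[OF W]])
      (use x velocity_has_vector_derivative[OF \<gamma> t c] in
        \<open>simp_all add: has_vector_derivative_def comp_def\<close>)
  then have "((\<lambda>s. local_metric M c (snd c (\<gamma> s)) (V s c) (W s c)) has_derivative (\<lambda>h. 0)) (at t within I)"
    unfolding comp_apply zero .
  then show ?thesis
  proof (rule has_derivative_transform_eventually)
    show "\<forall>\<^sub>F s in at t within I. local_metric M c (snd c (\<gamma> s)) (V s c) (W s c) = metric M (\<gamma> s) (V s) (W s)"
      using ev unfolding eventually_at_filter
      by eventually_elim (simp add: tan metric_eq_local_metric[symmetric])
    show "local_metric M c (snd c (\<gamma> t)) (V t c) (W t c) = metric M (\<gamma> t) (V t) (W t)"
      using tan[OF t] metric_eq_local_metric[OF c] by simp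
  qed (fact t)
qed

text \<open>With \<open>W\<close> the velocity of a geodesic this preserves the component of a
  parallel field along the curve; with both fields equal to the velocity it gives constant
  speed.\<close>

lemma parallel_metric_constant:
  assumes \<gamma>: "differentiable_curve_on M I \<gamma>" and I: "convex I" "s \<in> I" "t \<in> I"
    and V: "parallel_on M I \<gamma> V" and W: "parallel_on M I \<gamma> W"
  shows "metric M (\<gamma> s) (V s) (W s) = metric M (\<gamma> t) (V t) (W t)"
proof -
  have "\<exists>k. \<forall>t\<in>I. metric M (\<gamma> t) (V t) (W t) = k"
    by (rule has_derivative_zero_constant[OF I(1)])
      (use parallel_metric_has_derivative_zero[OF \<gamma> _ V W] in simp)
  then show ?thesis using I by auto
qed

text \<open>The second derivative of the coordinate change cancels against the transformation law of the
  Christoffel symbols.\<close>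
lemma parallel_on_of_coordinates:
  assumes \<gamma>: "differentiable_curve_on M I \<gamma>" and c: "\<And>t. t \<in> I \<Longrightarrow> c \<in> charts_at M (\<gamma> t)"
    and y: "\<And>t. t \<in> I \<Longrightarrow> (y has_vector_derivative
        - christoffel M c (snd c (\<gamma> t)) (velocity M I \<gamma> t c) (y t)) (at t within I)"
    and I: "\<And>t. t \<in> I \<Longrightarrow> at t within I \<noteq> bot"
  shows "parallel_on M I \<gamma> (\<lambda>t. tangent_of M c (\<gamma> t) (y t))"
  unfolding parallel_on_def
proof (intro conjI ballI)
  fix t assume t: "t \<in> I"
  show "tangent_of M c (\<gamma> t) (y t) \<in> tangent_space M (\<gamma> t)" by (rule tangent_of_in[OF c[OF t]])
  fix c' assume c': "c' \<in> charts_at M (\<gamma> t)"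
  let ?\<phi> = "snd c' \<circ> chart_inv c" and ?T = "dtrans c c' (\<gamma> t)" and ?v = "velocity M I \<gamma> t"
  let ?x = "snd c (\<gamma> t)"
  let ?G = "christoffel M c ?x (?v c) (y t)"
  note cc = c[OF t] c'
  have T: "linear ?T" by (rule linear_dtrans[OF cc])
  have H: "d2trans c c' (\<gamma> t) (y t) (h *\<^sub>R u) = h *\<^sub>R d2trans c c' (\<gamma> t) (y t) u" for h u
    using has_derivative_linear[OF d2trans_has_derivative[OF cc]] linear_cmul by blast
  have cont: "continuous_on I \<gamma>" using \<gamma> by (simp add: differentiable_curve_on_def)
  have ev: "\<forall>\<^sub>F s in at t within I. s \<in> I \<and> c' \<in> charts_at M (\<gamma> s)"
    using eventually_in_chart[OF cont t c'] by (simp add: eventually_at_filter)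
  have "((\<lambda>s. frechet_derivative ?\<phi> (at (snd c (\<gamma> s))) (y s)) has_derivative
      (\<lambda>h. d2trans c c' (\<gamma> t) (y t) (h *\<^sub>R ?v c)
        + frechet_derivative ?\<phi> (at (snd c (\<gamma> t))) (h *\<^sub>R - ?G))) (at t within I)"
  proof (rule has_derivative_linear_family[where D = "\<lambda>u h. d2trans c c' (\<gamma> t) u (h *\<^sub>R ?v c)", OF t])
    show "\<forall>\<^sub>F s in at t within I. linear (frechet_derivative ?\<phi> (at (snd c (\<gamma> s))))"
      using ev by eventually_elim (use linear_dtrans[OF c] in \<open>simp add: dtrans_def\<close>)
    show "linear (frechet_derivative ?\<phi> (at (snd c (\<gamma> t))))" using T by (simp add: dtrans_def)
    have "((\<lambda>s. snd c (\<gamma> s)) has_derivative (\<lambda>h. h *\<^sub>R ?v c)) (at t within I)"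
      using velocity_has_vector_derivative[OF \<gamma> t c[OF t]] by (simp add: has_vector_derivative_def comp_def)
    then show "((\<lambda>s. frechet_derivative ?\<phi> (at (snd c (\<gamma> s))) u) has_derivative
        (\<lambda>h. d2trans c c' (\<gamma> t) u (h *\<^sub>R ?v c))) (at t within I)" for u
      by (rule has_derivative_compose[where g = "\<lambda>x. frechet_derivative ?\<phi> (at x) u"
            and f = "\<lambda>s. snd c (\<gamma> s)", OF _ d2trans_has_derivative[OF cc]])
    show "(y has_derivative (\<lambda>h. h *\<^sub>R - ?G)) (at t within I)"
      using y[OF t] by (simp add: has_vector_derivative_def)
  qed
  then have "((\<lambda>s. tangent_of M c (\<gamma> s) (y s) c') has_derivative
      (\<lambda>h. d2trans c c' (\<gamma> t) (y t) (h *\<^sub>R ?v c) + ?T (h *\<^sub>R - ?G))) (at t within I)"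
    unfolding dtrans_def[symmetric]
  proof (rule has_derivative_transform_eventually)
    show "\<forall>\<^sub>F s in at t within I. dtrans c c' (\<gamma> s) (y s) = tangent_of M c (\<gamma> s) (y s) c'"
      using ev by eventually_elim (simp add: tangent_of_apply)
  qed (use t c' in \<open>simp_all add: tangent_of_apply\<close>)
  moreover have "d2trans c c' (\<gamma> t) (y t) (h *\<^sub>R ?v c) + ?T (h *\<^sub>R - ?G) =
      h *\<^sub>R - christoffel M c' (snd c' (\<gamma> t)) (?v c') (tangent_of M c (\<gamma> t) (y t) c')" for h
  proof -
    have v: "?v c' = ?T (?v c)"
      using velocity_in_tangent_space[OF \<gamma> t I[OF t]] cc unfolding tangent_space_iff by blast
    have y: "tangent_of M c (\<gamma> t) (y t) c' = ?T (y t)" using c' by (simp add: tangent_of_apply)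
    show ?thesis
      unfolding v y H linear_cmul[OF T] linear_neg[OF T] christoffel_change[OF cc]
      by (simp add: d2trans_sym[OF cc, of "y t"] algebra_simps)
  qed
  ultimately show "((\<lambda>s. tangent_of M c (\<gamma> s) (y s) c') has_vector_derivative
      - christoffel M c' (snd c' (\<gamma> t)) (?v c') (tangent_of M c (\<gamma> t) (y t) c')) (at t within I)"
    unfolding has_vector_derivative_def by simp
qed

text \<open>By Koszul's formula the Christoffel vector represents a functional built from
  \<open>dmetric\<close>. The auxiliary facts move the varying vector \<open>v t\<close> into the
  first and second slots of \<open>dmetric\<close> by expanding it in the basis.\<close>

lemma christoffel_continuous_along:
  assumes c: "c \<in> atlas M" and x: "\<And>t. t \<in> {a..b::real} \<Longrightarrow> \<xi> t \<in> snd c ` fst c"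
    and \<xi>: "continuous_on {a..b} \<xi>" and v: "continuous_on {a..b} v"
  shows "continuous_on {a..b} (\<lambda>t. christoffel M c (\<xi> t) (v t) w)"
proof -
  have d: "continuous_on {a..b} (\<lambda>t. dmetric c (\<xi> t) u1 u2 u3)" for u1 u2 u3
    by (rule continuous_on_compose2[OF continuous_on_dmetric[OF c] \<xi>]) (use x in auto)
  have d1: "continuous_on {a..b} (\<lambda>t. dmetric c (\<xi> t) (v t) u2 u3)" for u2 u3
  proof (rule continuous_on_eq)
    show "continuous_on {a..b} (\<lambda>t. \<Sum>i\<in>Basis. (v t \<bullet> i) * dmetric c (\<xi> t) i u2 u3)"
      by (intro continuous_intros v d)
  qed (rule linear_functional_expansion[OF dmetric_linear1[OF c x], symmetric])
  have d2: "continuous_on {a..b} (\<lambda>t. dmetric c (\<xi> t) u1 (v t) u3)" for u1 u3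
  proof (rule continuous_on_eq)
    show "continuous_on {a..b} (\<lambda>t. \<Sum>i\<in>Basis. (v t \<bullet> i) * dmetric c (\<xi> t) u1 i u3)"
      by (intro continuous_intros v d)
  qed (rule linear_functional_expansion[OF dmetric_linear2[OF c x], symmetric])
  show ?thesis
  proof (rule continuous_on_representation[where B = "\<lambda>t. local_metric M c (\<xi> t)"
        and l = "\<lambda>t y. (dmetric c (\<xi> t) (v t) w y + dmetric c (\<xi> t) w (v t) y
          - dmetric c (\<xi> t) y (v t) w) / 2"])
    show "compact {a..b}" by simp
    show "pos_def_form (local_metric M c (\<xi> t))" if "t \<in> {a..b}" for t
      by (rule local_metric_pos_def[OF c x[OF that]])
    show "continuous_on {a..b} (\<lambda>t. local_metric M c (\<xi> t) u w)" for u w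
      by (rule continuous_on_compose2[OF smooth_on_continuous[OF local_metric_smooth[OF c]] \<xi>])
        (use x in auto)
    show "continuous_on {a..b} (\<lambda>t. (dmetric c (\<xi> t) (v t) w y + dmetric c (\<xi> t) w (v t) y
          - dmetric c (\<xi> t) y (v t) w) / 2)" for y
      by (intro continuous_intros d1 d2) simp
    show "local_metric M c (\<xi> t) (christoffel M c (\<xi> t) (v t) w) y =
        (dmetric c (\<xi> t) (v t) w y + dmetric c (\<xi> t) w (v t) y - dmetric c (\<xi> t) y (v t) w) / 2"
      if "t \<in> {a..b}" for t y
      using Koszul[OF c x[OF that], of "v t" w y] by simp
  qed
qed

subsection \<open>Geodesics\<close>

text \<open>\<open>riem_exp\<close> uses geodesics on the whole line, whereas
  \<open>lipschitz_grad\<close> and \<open>parallel_transport\<close> use closed intervals with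
  one-sided derivatives at the ends. On a nondegenerate interval the two velocities agree, also at
  the ends.\<close>

lemma velocity_restrict:
  assumes \<gamma>: "differentiable_curve_on M UNIV \<gamma>" and t: "a < b" "t \<in> {a..b}"
  shows "velocity M {a..b} \<gamma> t = velocity M UNIV \<gamma> t"
proof
  fix c
  show "velocity M {a..b} \<gamma> t c = velocity M UNIV \<gamma> t c"
  proof (cases "c \<in> charts_at M (\<gamma> t)")
    case True
    have "((snd c \<circ> \<gamma>) has_vector_derivative velocity M UNIV \<gamma> t c) (at t)"
      using velocity_has_vector_derivative[OF \<gamma> UNIV_I True] by simp
    then have "vector_derivative (snd c \<circ> \<gamma>) (at t within {a..b}) = velocity M UNIV \<gamma> t c"
      using t by (intro vector_derivative_at_within_ivl) auto
    then show ?thesis using True by (simp add: velocity_def)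
  qed (simp add: velocity_def)
qed

lemma differentiable_curve_restrict:
  "differentiable_curve_on M UNIV \<gamma> \<Longrightarrow> differentiable_curve_on M I \<gamma>"
  unfolding differentiable_curve_on_def
  by (meson UNIV_I continuous_on_subset differentiable_within_subset subset_UNIV)

lemma geodesic_restrict:
  assumes \<gamma>: "geodesic_on M UNIV \<gamma>" and ab: "a < b"
  shows "geodesic_on M {a..b} \<gamma>"
proof -
  have d: "differentiable_curve_on M UNIV \<gamma>" and p: "parallel_on M UNIV \<gamma> (velocity M UNIV \<gamma>)"
    using \<gamma> by (auto simp: geodesic_on_def)
  note eq = velocity_restrict[OF d ab]
  have "parallel_on M {a..b} \<gamma> (velocity M {a..b} \<gamma>)"
    unfolding parallel_on_def
  proof (intro conjI ballI)
    fix t assume t: "t \<in> {a..b}"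
    show "velocity M {a..b} \<gamma> t \<in> tangent_space M (\<gamma> t)"
      using p unfolding eq[OF t] parallel_on_def by blast
    fix c assume c: "c \<in> charts_at M (\<gamma> t)"
    have "((\<lambda>s. velocity M UNIV \<gamma> s c) has_vector_derivative
       - christoffel M c (snd c (\<gamma> t)) (velocity M UNIV \<gamma> t c) (velocity M UNIV \<gamma> t c)) (at t within {a..b})"
      using p c unfolding parallel_on_def by (auto intro: has_vector_derivative_at_within)
    then show "((\<lambda>s. velocity M {a..b} \<gamma> s c) has_vector_derivative
       - christoffel M c (snd c (\<gamma> t)) (velocity M {a..b} \<gamma> t c) (velocity M {a..b} \<gamma> t c)) (at t within {a..b})"
      unfolding eq[OF t]
      by (rule has_vector_derivative_transform[OF t, rotated]) (simp add: eq)
  qed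
  then show ?thesis using differentiable_curve_restrict[OF d] by (simp add: geodesic_on_def)
qed

lemma geodesic_speed_constant:
  assumes \<gamma>: "geodesic_on M UNIV \<gamma>"
  shows "tnorm M (\<gamma> t) (velocity M UNIV \<gamma> t) = tnorm M (\<gamma> 0) (velocity M UNIV \<gamma> 0)"
  unfolding tnorm_def
  using \<gamma> parallel_metric_constant[of UNIV \<gamma> t 0] by (simp add: geodesic_on_def)

section \<open>Lengths of curves and the distance along a geodesic\<close>

text \<open>Supplies the lower bound without which the real infimum in \<open>riem_dist\<close>
  could not be compared with the length of a single curve.\<close>

lemma curve_length_nonneg:
  assumes "piecewise_C1_curve M n \<tau> \<gamma>"
  shows "curve_length M n \<tau> \<gamma> \<ge> 0"
  unfolding curve_length_def
proof (rule sum_nonneg)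
  fix i assume "i \<in> {..<n}"
  then have lt: "\<tau> i < \<tau> (Suc i)" and d: "differentiable_curve_on M {\<tau> i..\<tau> (Suc i)} \<gamma>"
    using assms by (auto simp: piecewise_C1_curve_def C1_curve_on_def)
  let ?v = "\<lambda>t. tnorm M (\<gamma> t) (velocity M {\<tau> i..\<tau> (Suc i)} \<gamma> t)"
  have "?v t \<ge> 0" if "t \<in> {\<tau> i..\<tau> (Suc i)}" for t
    using velocity_in_tangent_space[OF d that] that lt
    by (intro tnorm_nonneg) (simp add: trivial_limit_within islimpt_Icc)
  \<comment> \<open>If the speed were not integrable, the integral would have the default value 0,
    so both cases are nonnegative.\<close>
  then show "0 \<le> integral {\<tau> i..\<tau> (Suc i)} ?v"
    by (cases "?v integrable_on {\<tau> i..\<tau> (Suc i)}")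
      (auto intro: integral_nonneg simp: not_integrable_integral)
qed

text \<open>The geodesic itself, taken as a single piece, is a competitor in the infimum, and its
  constant speed makes the length explicit.\<close>

lemma riem_dist_le_geodesic:
  assumes \<gamma>: "geodesic_on M UNIV \<gamma>" and ab: "a < b"
  shows "riem_dist M (\<gamma> a) (\<gamma> b) \<le> (b - a) * tnorm M (\<gamma> 0) (velocity M UNIV \<gamma> 0)"
proof -
  let ?S = "{curve_length M n \<tau> \<sigma> | n \<tau> \<sigma>. piecewise_C1_curve M n \<tau> \<sigma> \<and> \<sigma> (\<tau> 0) = \<gamma> a \<and> \<sigma> (\<tau> n) = \<gamma> b}"
  define \<tau> where "\<tau> i = (if i = 0 then a else b)" for i :: nat
  have d: "differentiable_curve_on M UNIV \<gamma>" using \<gamma> by (simp add: geodesic_on_def)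
  have g: "geodesic_on M {a..b} \<gamma>" by (rule geodesic_restrict[OF \<gamma> ab])
  have "C1_curve_on M {a..b} \<gamma>"
    unfolding C1_curve_on_def
  proof (intro conjI ballI)
    show "differentiable_curve_on M {a..b} \<gamma>" using g by (simp add: geodesic_on_def)
    fix c assume c: "c \<in> atlas M"
    show "continuous_on {t \<in> {a..b}. \<gamma> t \<in> fst c} (\<lambda>t. velocity M {a..b} \<gamma> t c)"
      unfolding continuous_on_eq_continuous_within
    proof
      fix t assume t: "t \<in> {t \<in> {a..b}. \<gamma> t \<in> fst c}"
      then have "c \<in> charts_at M (\<gamma> t)" "t \<in> {a..b}" using c by (auto simp: charts_at_iff)
      then have "((\<lambda>s. velocity M {a..b} \<gamma> s c) has_vector_derivative - christoffel M c (snd c (\<gamma> t))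
          (velocity M {a..b} \<gamma> t c) (velocity M {a..b} \<gamma> t c)) (at t within {a..b})"
        using g unfolding geodesic_on_def parallel_on_def by blast
      then have "continuous (at t within {a..b}) (\<lambda>t. velocity M {a..b} \<gamma> t c)"
        by (rule has_vector_derivative_continuous)
      then show "continuous (at t within {t \<in> {a..b}. \<gamma> t \<in> fst c}) (\<lambda>t. velocity M {a..b} \<gamma> t c)"
        by (rule continuous_within_subset) auto
    qed
  qed
  then have "piecewise_C1_curve M 1 \<tau> \<gamma>" using ab by (simp add: piecewise_C1_curve_def \<tau>_def)
  moreover have "\<gamma> (\<tau> 0) = \<gamma> a" "\<gamma> (\<tau> 1) = \<gamma> b" by (simp_all add: \<tau>_def)
  ultimately have "curve_length M 1 \<tau> \<gamma> \<in> ?S"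
    by (intro CollectI exI[of _ 1] exI[of _ \<tau>] exI[of _ \<gamma>] conjI refl)
  moreover have "bdd_below ?S"
  proof (rule bdd_belowI[of _ 0])
    show "0 \<le> l" if "l \<in> ?S" for l using that curve_length_nonneg by blast
  qed
  ultimately have "riem_dist M (\<gamma> a) (\<gamma> b) \<le> curve_length M 1 \<tau> \<gamma>"
    unfolding riem_dist_def by (rule cInf_lower)
  also have "curve_length M 1 \<tau> \<gamma> = integral {a..b} (\<lambda>t. tnorm M (\<gamma> t) (velocity M {a..b} \<gamma> t))"
    by (simp add: curve_length_def \<tau>_def)
  also have "\<dots> = integral {a..b} (\<lambda>t. tnorm M (\<gamma> 0) (velocity M UNIV \<gamma> 0))"
    using geodesic_speed_constant[OF \<gamma>]
    by (intro integral_cong) (simp only: velocity_restrict[OF d ab])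
  also have "\<dots> = (b - a) * tnorm M (\<gamma> 0) (velocity M UNIV \<gamma> 0)" using ab by simp
  finally show ?thesis .
qed

section \<open>Existence of parallel fields on short intervals\<close>

text \<open>One radius \<open>d\<close> must serve all short intervals containing \<open>x\<close>,
  with the initial vector prescribed at the left end rather than at \<open>x\<close>: this is the
  form that a subdivision argument consumes. It is available because on a compact neighbourhood of
  \<open>x\<close> inside one chart the coefficients of the equation have a common operator
  bound.\<close>

lemma parallel_field_local_exists:
  assumes \<gamma>: "geodesic_on M UNIV \<gamma>"
  shows "\<exists>d>0. \<forall>a b. a \<le> x \<and> x \<le> b \<and> a < b \<and> b - a < d \<longrightarrow>
    (\<forall>u\<in>tangent_space M (\<gamma> a). \<exists>V. parallel_on M {a..b} \<gamma> V \<and> V a = u)"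
proof -
  have d: "differentiable_curve_on M UNIV \<gamma>" and p: "parallel_on M UNIV \<gamma> (velocity M UNIV \<gamma>)"
    using \<gamma> by (auto simp: geodesic_on_def)
  have cont: "continuous_on UNIV \<gamma>" using d by (simp add: differentiable_curve_on_def)
  obtain c where c: "c \<in> charts_at M (\<gamma> x)" using ex_chart by blast
  have at: "c \<in> atlas M" using c by (simp add: charts_at_iff)
  have "open (\<gamma> -` fst c)" using cont open_chart[OF at] by (simp add: open_vimage)
  moreover have "x \<in> \<gamma> -` fst c" using c by (simp add: charts_at_iff)
  ultimately obtain r where r: "r > 0" "cball x r \<subseteq> \<gamma> -` fst c" using open_contains_cball by metis
  define J where "J = {x - r..x + r}"
  have J: "c \<in> charts_at M (\<gamma> t)" if "t \<in> J" for t
    using r that at unfolding J_def cball_eq_atLeastAtMost charts_at_iff by blast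
  define v where "v t = velocity M UNIV \<gamma> t c" for t
  define A where "A t w = - christoffel M c (snd c (\<gamma> t)) (v t) w" for t w
  have im: "snd c (\<gamma> t) \<in> snd c ` fst c" if "t \<in> J" for t using J[OF that] by (simp add: charts_at_iff)
  have contA: "continuous_on J (\<lambda>t. A t w)" for w
  proof -
    have "continuous_on J (\<lambda>t. snd c (\<gamma> t))"
      by (rule continuous_on_compose2[OF chart_continuous[OF at] continuous_on_subset[OF cont]])
        (use J in \<open>auto simp: charts_at_iff\<close>)
    moreover have "continuous_on J v"
      unfolding continuous_on_eq_continuous_within v_def
      using p J unfolding parallel_on_def
      by (meson UNIV_I continuous_within_subset has_vector_derivative_continuous subset_UNIV)
    ultimately show ?thesis
      unfolding A_def J_def by (intro continuous_intros christoffel_continuous_along at) (use im J_def in auto)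
  qed
  have linA: "linear (A t)" if "t \<in> J" for t
    using linear_compose_neg[OF linear_christoffel[OF at im[OF that], of "v t"]] unfolding A_def .
  have "\<exists>B. \<forall>t\<in>J. norm (A t w) \<le> B" for w
  proof -
    have "compact ((\<lambda>t. A t w) ` J)" using contA by (intro compact_continuous_image) (auto simp: J_def)
    then show ?thesis using compact_imp_bounded bounded_iff by (metis image_eqI)
  qed
  \<comment> \<open>A separate bound for each vector; summing over the basis turns these into one
    operator bound \<open>K\<close>.\<close>
  then obtain B where B: "\<And>w t. t \<in> J \<Longrightarrow> norm (A t w) \<le> B w" by metis
  define K where "K = (\<Sum>i\<in>Basis. \<bar>B i\<bar>)"
  have K: "K \<ge> 0" by (simp add: K_def sum_nonneg)
  have bnd: "norm (A t w) \<le> K * norm w" if t: "t \<in> J" for t w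
  proof -
    have "norm (A t w) = norm (\<Sum>i\<in>Basis. (w \<bullet> i) *\<^sub>R A t i)"
      by (simp only: linear_expansion[OF linA[OF t], symmetric])
    also have "\<dots> \<le> (\<Sum>i\<in>Basis. norm ((w \<bullet> i) *\<^sub>R A t i))" by (rule norm_sum)
    also have "\<dots> \<le> (\<Sum>i\<in>Basis. norm w * \<bar>B i\<bar>)"
    proof (rule sum_mono)
      fix i :: 'e assume "i \<in> Basis"
      have "norm (A t i) \<le> \<bar>B i\<bar>" using B[OF t, of i] by simp
      then show "norm ((w \<bullet> i) *\<^sub>R A t i) \<le> norm w * \<bar>B i\<bar>"
        using Basis_le_norm[OF \<open>i \<in> Basis\<close>, of w] by (simp add: mult_mono)
    qed
    finally show ?thesis by (simp add: K_def sum_distrib_left mult.commute[of _ "norm w"])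
  qed
  \<comment> \<open>The radius \<open>r\<close> keeps \<open>{a..b}\<close> inside the chart
    interval \<open>J\<close>, and 1 / (K + 1) makes K (b - a) < 1, also when \<open>K\<close> is
    0.\<close>
  define e where "e = min r (1 / (K + 1))"
  have e: "e > 0" using r K by (simp add: e_def)
  moreover have "\<exists>V. parallel_on M {a..b} \<gamma> V \<and> V a = u"
    if ab: "a \<le> x" "x \<le> b" "a < b" "b - a < e" and u: "u \<in> tangent_space M (\<gamma> a)" for a b u
  proof -
    have sub: "{a..b} \<subseteq> J" using ab by (auto simp: J_def e_def)
    have aJ: "a \<in> J" using sub ab by auto
    have "K * (b - a) \<le> K * e" using ab K by (intro mult_left_mono) auto
    also have "\<dots> \<le> K * (1 / (K + 1))" using K by (intro mult_left_mono) (auto simp: e_def)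
    also have "\<dots> < 1" using K by simp
    finally have Kab: "K * (b - a) < 1" .
    obtain y where y: "y a = u c"
      "\<And>t. t \<in> {a..b} \<Longrightarrow> (y has_vector_derivative A t (y t)) (at t within {a..b})"
      using linear_ode_local_exists[OF less_imp_le[OF ab(3)] linA[OF subsetD[OF sub]]
          continuous_on_subset[OF contA sub] bnd[OF subsetD[OF sub]] Kab K] by blast
    have "parallel_on M {a..b} \<gamma> (\<lambda>t. tangent_of M c (\<gamma> t) (y t))"
    proof (rule parallel_on_of_coordinates)
      show "differentiable_curve_on M {a..b} \<gamma>" by (rule differentiable_curve_restrict[OF d])
      show "c \<in> charts_at M (\<gamma> t)" if "t \<in> {a..b}" for t using J that sub by blast
      show "at t within {a..b} \<noteq> bot" if "t \<in> {a..b}" for t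
        using that ab by (simp add: trivial_limit_within islimpt_Icc)
      show "(y has_vector_derivative - christoffel M c (snd c (\<gamma> t)) (velocity M {a..b} \<gamma> t c) (y t))
          (at t within {a..b})" if "t \<in> {a..b}" for t
        using y(2)[OF that] unfolding A_def v_def velocity_restrict[OF d ab(3) that] .
    qed
    moreover have "tangent_of M c (\<gamma> a) (y a) = u"
      unfolding y(1) by (rule tangent_of_component[OF u J[OF aJ]])
    ultimately show ?thesis by blast
  qed
  ultimately show ?thesis by blast
qed

subsection \<open>The descent inequality\<close>

lemma differential_change:
  assumes f: "differentiable_fun M f" and c: "c \<in> charts_at M p" "c' \<in> charts_at M p"
  shows "frechet_derivative (f \<circ> chart_inv c') (at (snd c' p)) (dtrans c c' p u) =
    frechet_derivative (f \<circ> chart_inv c) (at (snd c p)) u"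
proof -
  have at: "c \<in> atlas M" "c' \<in> atlas M" "p \<in> fst c" "p \<in> fst c'" using c by (auto simp: charts_at_iff)
  have d: "((f \<circ> chart_inv c) has_derivative frechet_derivative (f \<circ> chart_inv c) (at (snd c p)))
      (at (snd c p))" if "c \<in> charts_at M p" for c
    using f that unfolding differentiable_fun_def frechet_derivative_works by blast
  have "(snd c' \<circ> chart_inv c) (snd c p) = snd c' p" using at by (simp add: chart_inv_chart)
  then have "((f \<circ> chart_inv c') \<circ> (snd c' \<circ> chart_inv c) has_derivative
      frechet_derivative (f \<circ> chart_inv c') (at (snd c' p)) \<circ> dtrans c c' p) (at (snd c p))"
    using d[OF c(2)] by (intro diff_chain_at transition_has_derivative[OF c]) simp
  then have "((f \<circ> chart_inv c) has_derivative
      frechet_derivative (f \<circ> chart_inv c') (at (snd c' p)) \<circ> dtrans c c' p) (at (snd c p))"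
    by (rule has_derivative_transform_within_open[OF _ open_overlap[OF at(1,2)]])
      (use at in \<open>auto simp: chart_inv_chart\<close>)
  then have "frechet_derivative (f \<circ> chart_inv c') (at (snd c' p)) \<circ> dtrans c c' p =
      frechet_derivative (f \<circ> chart_inv c) (at (snd c p))"
    using d[OF c(1)] by (rule has_derivative_unique)
  then show ?thesis by (metis comp_apply)
qed

text \<open>Makes the definite description in \<open>grad\<close> proper. A vector representing the
  differential in one chart \<open>c0\<close> represents it in all charts, because the differential
  is chart independent; uniqueness follows by testing against the difference of two
  candidates.\<close>

lemma
  assumes f: "differentiable_fun M f"
  shows grad_in_tangent_space: "grad M f p \<in> tangent_space M p"
    and metric_grad: "w \<in> tangent_space M p \<Longrightarrow> c \<in> charts_at M p \<Longrightarrow>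
      metric M p (grad M f p) w = frechet_derivative (f \<circ> chart_inv c) (at (snd c p)) (w c)"
proof -
  let ?d = "\<lambda>c. frechet_derivative (f \<circ> chart_inv c) (at (snd c p))"
  let ?P = "\<lambda>v. v \<in> tangent_space M p \<and>
    (\<forall>w\<in>tangent_space M p. \<forall>c\<in>charts_at M p. metric M p v w = ?d c (w c))"
  obtain c0 where c0: "c0 \<in> charts_at M p" using ex_chart by blast
  have at: "c0 \<in> atlas M" and x: "snd c0 p \<in> snd c0 ` fst c0" using c0 by (auto simp: charts_at_iff)
  have "linear (?d c0)"
    using f c0 unfolding differentiable_fun_def by (auto intro: linear_frechet_derivative)
  then obtain z where z: "\<And>y. local_metric M c0 (snd c0 p) z y = ?d c0 y"
    using pos_def_form_representation[OF local_metric_pos_def[OF at x]] by metis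
  have "?P (tangent_of M c0 p z)"
  proof (intro conjI ballI)
    show v: "tangent_of M c0 p z \<in> tangent_space M p" by (rule tangent_of_in[OF c0])
    fix w c assume w: "w \<in> tangent_space M p" and c: "c \<in> charts_at M p"
    have "metric M p (tangent_of M c0 p z) w = ?d c0 (w c0)"
      by (simp add: metric_eq_local_metric[OF c0 v w] tangent_of_self[OF c0] z)
    also have "\<dots> = ?d c (dtrans c0 c p (w c0))" by (rule differential_change[OF f c0 c, symmetric])
    also have "dtrans c0 c p (w c0) = w c" using w c0 c unfolding tangent_space_iff by metis
    finally show "metric M p (tangent_of M c0 p z) w = ?d c (w c)" .
  qed
  moreover have "v = v'" if "?P v" "?P v'" for v v'
  proof (rule ccontr)
    assume "v \<noteq> v'"
    then have "v - v' \<noteq> (\<lambda>_. 0)" by (auto simp: fun_eq_iff)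
    moreover have t: "v - v' \<in> tangent_space M p" using that by (intro tangent_space_diff) auto
    ultimately have "metric M p (v - v') (v - v') > 0" by (intro metric_pos)
    moreover have "metric M p (v - v') (v - v') = metric M p v (v - v') - metric M p v' (v - v')"
      using that t by (intro metric_diff) auto
    moreover have "metric M p v (v - v') = metric M p v' (v - v')" using that t c0 by metis
    ultimately show False by simp
  qed
  ultimately have "\<exists>!v. ?P v" by blast
  from theI'[OF this] have P: "?P (grad M f p)" unfolding grad_def .
  then show "grad M f p \<in> tangent_space M p" by blast
  show "metric M p (grad M f p) w = ?d c (w c)" if "w \<in> tangent_space M p" "c \<in> charts_at M p"
    using P that by blast
qed

lemma compose_curve_has_derivative:
  assumes f: "differentiable_fun M f" and \<gamma>: "differentiable_curve_on M UNIV \<gamma>"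
  shows "((\<lambda>s. f (\<gamma> s)) has_real_derivative metric M (\<gamma> t) (grad M f (\<gamma> t)) (velocity M UNIV \<gamma> t)) (at t)"
proof -
  obtain c where c: "c \<in> charts_at M (\<gamma> t)" using ex_chart by blast
  have at: "c \<in> atlas M" "\<gamma> t \<in> fst c" using c by (auto simp: charts_at_iff)
  let ?d = "frechet_derivative (f \<circ> chart_inv c) (at (snd c (\<gamma> t)))" and ?v = "velocity M UNIV \<gamma> t"
  have cont: "continuous_on UNIV \<gamma>" using \<gamma> by (simp add: differentiable_curve_on_def)
  have d: "((f \<circ> chart_inv c) has_derivative ?d) (at (snd c (\<gamma> t)))"
    using f c unfolding differentiable_fun_def frechet_derivative_works by blast
  have "((\<lambda>s. snd c (\<gamma> s)) has_derivative (\<lambda>h. h *\<^sub>R ?v c)) (at t)"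
    using velocity_has_vector_derivative[OF \<gamma> UNIV_I c] by (simp add: has_vector_derivative_def comp_def)
  then have "((\<lambda>s. (f \<circ> chart_inv c) (snd c (\<gamma> s))) has_derivative (\<lambda>h. ?d (h *\<^sub>R ?v c))) (at t)"
    using d by (rule has_derivative_compose)
  then have "((\<lambda>s. f (\<gamma> s)) has_derivative (\<lambda>h. ?d (h *\<^sub>R ?v c))) (at t)"
  proof (rule has_derivative_transform_eventually)
    show "\<forall>\<^sub>F s in at t. (f \<circ> chart_inv c) (snd c (\<gamma> s)) = f (\<gamma> s)"
      using eventually_in_chart[OF cont UNIV_I c]
      by eventually_elim (simp add: charts_at_iff chart_inv_chart)
  qed (use at in \<open>simp_all add: chart_inv_chart\<close>)
  moreover have "?d (h *\<^sub>R ?v c) = metric M (\<gamma> t) (grad M f (\<gamma> t)) ?v * h" for h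
    using linear_cmul[OF has_derivative_linear[OF d]]
      metric_grad[OF f velocity_in_tangent_space[OF \<gamma> UNIV_I] c] by simp
  ultimately show ?thesis by (simp add: has_field_derivative_def)
qed

lemma tnorm_minus_commute:
  assumes "v \<in> tangent_space M p" "w \<in> tangent_space M p"
  shows "tnorm M p (v - w) = tnorm M p (w - v)"
proof -
  have t: "v - w \<in> tangent_space M p" "w - v \<in> tangent_space M p"
    using tangent_space_diff assms by blast+
  have eq: "w - v = (\<lambda>c. (-1) *\<^sub>R (v - w) c)" by (simp add: fun_eq_iff)
  have "metric M p (w - v) (w - v) = - metric M p (v - w) (w - v)"
    using metric_scaleR[OF t, of "-1"] by (simp only: eq[symmetric])
  also have "metric M p (v - w) (w - v) = - metric M p (v - w) (v - w)"
    using metric_scaleR[OF t(1) t(1), of "-1"] metric_sym[OF t] by (simp only: eq[symmetric])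
  finally show ?thesis unfolding tnorm_def by (simp only: minus_minus)
qed

text \<open>The assumption \<open>ex\<close> makes the choice in \<open>parallel_transport\<close>
  effective: its value is then the end value of an actual parallel field. One factor of the speed
  comes from bounding the distance by the length of the geodesic, the other from Cauchy-Schwarz with
  the velocity.\<close>

lemma slope_diff_le_short:
  assumes f: "differentiable_fun M f" and L: "L \<ge> 0" "lipschitz_grad M f L"
    and \<gamma>: "geodesic_on M UNIV \<gamma>" and ab: "a < b"
    and ex: "\<exists>V. parallel_on M {a..b} \<gamma> V \<and> V a = grad M f (\<gamma> a)"
  defines "v \<equiv> velocity M UNIV \<gamma>"
  shows "metric M (\<gamma> b) (grad M f (\<gamma> b)) (v b) - metric M (\<gamma> a) (grad M f (\<gamma> a)) (v a)
    \<le> L * (b - a) * (tnorm M (\<gamma> 0) (v 0))\<^sup>2"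
proof -
  let ?w = "parallel_transport M a b \<gamma> (grad M f (\<gamma> a))" and ?g = "grad M f (\<gamma> b)"
    and ?s = "tnorm M (\<gamma> 0) (v 0)"
  have d: "differentiable_curve_on M UNIV \<gamma>" using \<gamma> by (simp add: geodesic_on_def)
  have g: "geodesic_on M {a..b} \<gamma>" by (rule geodesic_restrict[OF \<gamma> ab])
  have v: "velocity M {a..b} \<gamma> t = v t" if "t \<in> {a..b}" for t
    unfolding v_def by (rule velocity_restrict[OF d ab that])
  have "\<exists>w V. parallel_on M {a..b} \<gamma> V \<and> V a = grad M f (\<gamma> a) \<and> V b = w" using ex by blast
  from someI_ex[OF this] obtain V where V: "parallel_on M {a..b} \<gamma> V" "V a = grad M f (\<gamma> a)" "V b = ?w"
    unfolding parallel_transport_def[symmetric] by blast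
  have "V b \<in> tangent_space M (\<gamma> b)" using V(1) ab by (auto simp: parallel_on_def)
  then have tan: "?w \<in> tangent_space M (\<gamma> b)" "v b \<in> tangent_space M (\<gamma> b)" "?g \<in> tangent_space M (\<gamma> b)"
    using velocity_in_tangent_space[OF d UNIV_I] grad_in_tangent_space[OF f]
    unfolding V(3) v_def by simp_all
  have s: "?s \<ge> 0"
    unfolding v_def by (intro tnorm_nonneg velocity_in_tangent_space[OF d UNIV_I]) simp
  have lip: "tnorm M (\<gamma> b) (?w - ?g) \<le> L * riem_dist M (\<gamma> a) (\<gamma> b)"
    using L(2) ab g unfolding lipschitz_grad_def by blast
  have dist: "riem_dist M (\<gamma> a) (\<gamma> b) \<le> (b - a) * ?s"
    unfolding v_def by (rule riem_dist_le_geodesic[OF \<gamma> ab])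
  have "metric M (\<gamma> a) (V a) (velocity M {a..b} \<gamma> a) = metric M (\<gamma> b) (V b) (velocity M {a..b} \<gamma> b)"
    by (rule parallel_metric_constant[of "{a..b}"]) (use g V ab in \<open>auto simp: geodesic_on_def\<close>)
  then have "metric M (\<gamma> a) (grad M f (\<gamma> a)) (v a) = metric M (\<gamma> b) ?w (v b)"
    using ab by (simp add: V v)
  then have "metric M (\<gamma> b) ?g (v b) - metric M (\<gamma> a) (grad M f (\<gamma> a)) (v a) = metric M (\<gamma> b) (?g - ?w) (v b)"
    using metric_diff[OF tan(3,1,2)] by simp
  also have "\<dots> \<le> tnorm M (\<gamma> b) (?g - ?w) * tnorm M (\<gamma> b) (v b)"
    by (intro metric_Cauchy_Schwarz tangent_space_diff tan)
  also have "tnorm M (\<gamma> b) (v b) = ?s" unfolding v_def by (rule geodesic_speed_constant[OF \<gamma>])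
  also have "tnorm M (\<gamma> b) (?g - ?w) = tnorm M (\<gamma> b) (?w - ?g)" by (rule tnorm_minus_commute[OF tan(3,1)])
  also have "tnorm M (\<gamma> b) (?w - ?g) * ?s \<le> (L * riem_dist M (\<gamma> a) (\<gamma> b)) * ?s"
    using lip s by (rule mult_right_mono)
  also have "\<dots> \<le> (L * ((b - a) * ?s)) * ?s"
    by (intro mult_right_mono mult_left_mono dist L(1) s)
  finally show ?thesis by (simp add: power2_eq_square mult_ac)
qed

lemma slope_diff_le:
  assumes f: "differentiable_fun M f" and L: "L \<ge> 0" "lipschitz_grad M f L"
    and \<gamma>: "geodesic_on M UNIV \<gamma>" and ab: "a \<le> b"
  shows "metric M (\<gamma> b) (grad M f (\<gamma> b)) (velocity M UNIV \<gamma> b)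
      - metric M (\<gamma> a) (grad M f (\<gamma> a)) (velocity M UNIV \<gamma> a)
    \<le> L * (b - a) * (tnorm M (\<gamma> 0) (velocity M UNIV \<gamma> 0))\<^sup>2"
proof -
  define m where "m t = metric M (\<gamma> t) (grad M f (\<gamma> t)) (velocity M UNIV \<gamma> t)" for t
  define k where "k = (tnorm M (\<gamma> 0) (velocity M UNIV \<gamma> 0))\<^sup>2"
  have "m b - m a \<le> L * (b - a) * k"
    using ab
  \<comment> \<open>The bisection principle: a property of intervals that passes to concatenations
    and holds on all short intervals around each point holds on \<open>{a..b}\<close>. The local
    case includes degenerate intervals, where both sides vanish.\<close>
  proof (induction a b rule: Bolzano)
    case (trans a b c)
    have "m c - m a \<le> L * (c - b) * k + L * (b - a) * k" using trans by linarith
    then show ?case by (simp add: algebra_simps)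
  next
    case (local x)
    from parallel_field_local_exists[OF \<gamma>, of x] obtain d where d: "d > 0"
      "\<forall>a b. a \<le> x \<and> x \<le> b \<and> a < b \<and> b - a < d \<longrightarrow>
        (\<forall>u\<in>tangent_space M (\<gamma> a). \<exists>V. parallel_on M {a..b} \<gamma> V \<and> V a = u)" by (elim exE conjE)
    have "m b - m a \<le> L * (b - a) * k" if ab: "a \<le> x" "x \<le> b" "b - a < d" for a b
    proof (cases "a < b")
      case True
      then have "\<exists>V. parallel_on M {a..b} \<gamma> V \<and> V a = grad M f (\<gamma> a)"
        using d(2) ab grad_in_tangent_space[OF f, of "\<gamma> a"] by simp
      then show ?thesis unfolding m_def k_def by (rule slope_diff_le_short[OF f L \<gamma> True])
    next
      case False
      then have "a = b" using ab by simp
      then show ?thesis by simp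
    qed
    then show ?case using d(1) by blast
  qed
  then show ?thesis by (simp only: m_def k_def)
qed

text \<open>The integration of the slope bound takes the form of monotonicity: f(\<gamma> t) minus
  the quadratic upper model has nonpositive derivative on [0, 1], so no integral of the slope
  appears.\<close>

lemma descent_inequality:
  assumes M': "complete_riemannian_manifold M"
    and f: "differentiable_fun M f" and L: "L \<ge> 0" "lipschitz_grad M f L"
    and v: "v \<in> tangent_space M p"
  shows "f (riem_exp M p v) \<le> f p + metric M p (grad M f p) v + L / 2 * metric M p v v"
proof -
  \<comment> \<open>Completeness provides a candidate, so the point chosen by
    \<open>riem_exp\<close> is the end of some geodesic with the prescribed initial data.\<close>
  have "\<exists>q \<gamma>. geodesic_on M UNIV \<gamma> \<and> \<gamma> 0 = p \<and> velocity M UNIV \<gamma> 0 = v \<and> \<gamma> 1 = q"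
    using M' v unfolding complete_riemannian_manifold_def by blast
  from someI_ex[OF this] obtain \<gamma> where \<gamma>: "geodesic_on M UNIV \<gamma>" "\<gamma> 0 = p"
      "velocity M UNIV \<gamma> 0 = v" "\<gamma> 1 = riem_exp M p v"
    unfolding riem_exp_def[symmetric] by blast
  have d: "differentiable_curve_on M UNIV \<gamma>" using \<gamma> by (simp add: geodesic_on_def)
  define m where "m t = metric M (\<gamma> t) (grad M f (\<gamma> t)) (velocity M UNIV \<gamma> t)" for t
  define s where "s = metric M p v v"
  have m: "m t \<le> m 0 + L * s * t" if "t \<ge> 0" for t
    using slope_diff_le[OF f L \<gamma>(1) that] tnorm_power2[OF v] by (simp add: m_def \<gamma> s_def mult_ac)
  have "f (\<gamma> 1) - 1 * m 0 - L * s / 2 * 1\<^sup>2 \<le> f (\<gamma> 0) - 0 * m 0 - L * s / 2 * 0\<^sup>2"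
  proof (rule DERIV_nonpos_imp_nonincreasing[of 0 1 "\<lambda>t. f (\<gamma> t) - t * m 0 - L * s / 2 * t\<^sup>2"])
    fix t :: real assume t: "0 \<le> t" "t \<le> 1"
    have "((\<lambda>t. f (\<gamma> t) - t * m 0 - L * s / 2 * t\<^sup>2) has_real_derivative m t - m 0 - L * s * t) (at t)"
      using compose_curve_has_derivative[OF f d, of t, folded m_def]
      by (auto intro!: derivative_eq_intros)
    then show "\<exists>y. ((\<lambda>t. f (\<gamma> t) - t * m 0 - L * s / 2 * t\<^sup>2) has_real_derivative y) (at t) \<and> y \<le> 0"
      using m[OF t(1)] by force
  qed simp
  then show ?thesis by (simp add: \<gamma> m_def s_def)
qed

end

subsection \<open>The step-size recursion\<close>

text \<open>Once \<open>sqrt (\<beta> (Suc k))\<close> exceeds \<open>\<eta> * L\<close> every step decreases \<open>F\<close>; the index \<open>K\<close> is the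
  first such step, and \<open>\<beta> K \<le> \<eta>\<^sup>2 * L\<^sup>2\<close> controls the increase before it.\<close>
lemma adagrad_accumulator_bound:
  fixes F g \<beta> :: "nat \<Rightarrow> real" and L \<eta> fmin S :: real
  assumes \<eta>: "\<eta> > 0" and L: "L \<ge> 0" and g0: "g 0 > 0"
    and \<beta>0: "\<beta> 0 = 0" and \<beta>S: "\<And>k. \<beta> (Suc k) = \<beta> k + (g k)\<^sup>2"
    and desc: "\<And>k. F (Suc k) \<le> F k - \<eta> / sqrt (\<beta> (Suc k)) * (g k)\<^sup>2
      + L / 2 * (\<eta> / sqrt (\<beta> (Suc k)))\<^sup>2 * (g k)\<^sup>2"
    and fmin: "\<And>k. fmin \<le> F k"
    and S: "S = L + 2 * (F 0 - fmin) / \<eta>\<^sup>2 + \<eta>\<^sup>2 * L ^ 3 / (g 0)\<^sup>2"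
  shows "\<beta> n \<le> (\<eta> ^ 3 * L\<^sup>2 / g 0 + 2 * (F 0 - fmin) + \<eta> ^ 4 * L ^ 3 / (g 0)\<^sup>2) * S"
proof -
  \<comment> \<open>Bounds \<open>2 * (F K - F n)\<close>: twice the initial gap plus twice the
    largest increase before the steps become short. The constant \<open>S\<close> equals
    \<open>L + E / \<eta>\<^sup>2\<close>.\<close>
  define E where "E = 2 * (F 0 - fmin) + \<eta> ^ 4 * L ^ 3 / (g 0)\<^sup>2"
  have E: "E \<ge> 0" using fmin[of 0] \<eta> L by (simp add: E_def)
  have SE: "S = L + E / \<eta>\<^sup>2"
    using \<eta> by (simp add: S E_def add_divide_distrib) (simp add: field_simps power_numeral_reduce)
  have SL: "S \<ge> L" using E by (simp add: SE)
  have S0: "S \<ge> 0" using SL L by simp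
  have mono: "\<beta> i \<le> \<beta> j" if "i \<le> j" for i j
    using that by (induction rule: dec_induct) (simp_all add: \<beta>S add_increasing2)
  have \<beta>1: "(g 0)\<^sup>2 \<le> \<beta> (Suc k)" for k
    using mono[of 1 "Suc k"] \<beta>S[of 0] \<beta>0 by simp
  have \<beta>pos: "\<beta> (Suc k) > 0" for k
    using \<beta>1[of k] zero_less_power[OF g0, of 2] by linarith
  have \<beta>nn: "\<beta> k \<ge> 0" for k using mono[of 0 k] \<beta>0 by simp
  \<comment> \<open>Source of the first term of the bound. For k > 0 the hypothesis forces g 0 \<le>
    \<eta> L \<le> \<eta> S, so \<eta>^2 L^2 may be enlarged by the factor \<eta> S / g 0, which is
    at least 1.\<close>
  have small: "\<beta> k \<le> \<eta> ^ 3 * L\<^sup>2 / g 0 * S" if "\<beta> k \<le> \<eta>\<^sup>2 * L\<^sup>2" for k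
  proof (cases k)
    case 0
    then show ?thesis using \<beta>0 \<eta> L g0 S0 by simp
  next
    case (Suc j)
    then have "(g 0)\<^sup>2 \<le> (\<eta> * L)\<^sup>2" using \<beta>1[of j] that by (simp add: power_mult_distrib)
    then have "g 0 \<le> \<eta> * L" by (rule power2_le_imp_le) (use \<eta> L in simp)
    also have "\<dots> \<le> \<eta> * S" using SL \<eta> by simp
    finally have "\<eta>\<^sup>2 * L\<^sup>2 * g 0 \<le> \<eta>\<^sup>2 * L\<^sup>2 * (\<eta> * S)" by (rule mult_left_mono) simp
    then have "\<eta>\<^sup>2 * L\<^sup>2 \<le> \<eta> ^ 3 * L\<^sup>2 / g 0 * S"
      using g0 by (simp add: field_simps power_numeral_reduce)
    then show ?thesis using that by simp
  qed
  \<comment> \<open>The negative term of the descent inequality is dropped, and the step sizes are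
    bounded through \<open>\<beta> (Suc k) \<ge> (g 0)\<^sup>2\<close>; the squared norms then add
    up to \<open>\<beta> k\<close>.\<close>
  have increase: "F k \<le> F 0 + L * \<eta>\<^sup>2 / (2 * (g 0)\<^sup>2) * \<beta> k" for k
  proof (induction k)
    case 0
    then show ?case by (simp add: \<beta>0)
  next
    case (Suc k)
    have "(\<eta> / sqrt (\<beta> (Suc k)))\<^sup>2 = \<eta>\<^sup>2 / \<beta> (Suc k)" using \<beta>pos[of k] by (simp add: power_divide)
    also have "\<dots> \<le> \<eta>\<^sup>2 / (g 0)\<^sup>2" using \<beta>1[of k] \<beta>pos[of k] g0 by (intro divide_left_mono) auto
    finally have "L / 2 * (\<eta> / sqrt (\<beta> (Suc k)))\<^sup>2 * (g k)\<^sup>2 \<le> L / 2 * (\<eta>\<^sup>2 / (g 0)\<^sup>2) * (g k)\<^sup>2"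
      using L by (intro mult_right_mono mult_left_mono) auto
    moreover have "\<eta> / sqrt (\<beta> (Suc k)) * (g k)\<^sup>2 \<ge> 0" using \<eta> \<beta>pos[of k] by simp
    ultimately have "F (Suc k) \<le> F k + L / 2 * (\<eta>\<^sup>2 / (g 0)\<^sup>2) * (g k)\<^sup>2" using desc[of k] by linarith
    moreover have "L * \<eta>\<^sup>2 / (2 * (g 0)\<^sup>2) * \<beta> (Suc k) =
        L * \<eta>\<^sup>2 / (2 * (g 0)\<^sup>2) * \<beta> k + L / 2 * (\<eta>\<^sup>2 / (g 0)\<^sup>2) * (g k)\<^sup>2"
      by (simp add: \<beta>S distrib_left)
    ultimately show ?case using Suc by linarith
  qed
  \<comment> \<open>Here L times the step size is at most 1, so the quadratic term eats at most half
    of the linear one. Multiplying by the square root prepares for replacing it by its largest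
    value.\<close>
  have decrease: "\<eta> * (g k)\<^sup>2 \<le> sqrt (\<beta> (Suc k)) * (2 * (F k - F (Suc k)))" if "\<beta> (Suc k) > \<eta>\<^sup>2 * L\<^sup>2" for k
  proof -
    let ?r = "sqrt (\<beta> (Suc k))"
    have r: "?r > 0" using \<beta>pos[of k] by simp
    have "\<eta> * L = sqrt (\<eta>\<^sup>2 * L\<^sup>2)" using \<eta> L by (simp add: real_sqrt_mult)
    also have "\<dots> \<le> ?r" using that by simp
    finally have "L * (\<eta> / ?r) \<le> 1" using r by (simp add: field_simps)
    then have "L * (\<eta> / ?r) * (\<eta> / ?r * (g k)\<^sup>2) \<le> 1 * (\<eta> / ?r * (g k)\<^sup>2)"
      using \<eta> r by (intro mult_right_mono) auto
    then have "\<eta> / ?r * (g k)\<^sup>2 \<le> 2 * (F k - F (Suc k))"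
      using desc[of k] by (simp add: power2_eq_square mult_ac)
    then show ?thesis using r by (simp add: field_simps)
  qed
  show ?thesis
  proof (cases "\<beta> n \<le> \<eta>\<^sup>2 * L\<^sup>2")
    case True
    have "E * S \<ge> 0" using E S0 by simp
    then show ?thesis using small[OF True] by (simp add: E_def algebra_simps)
  next
    case False
    then have "n \<noteq> 0" using \<beta>0 by (metis mult_nonneg_nonneg zero_le_power2)
    then obtain m where m: "n = Suc m" using not0_implies_Suc by blast
    define K where "K = (LEAST k. \<beta> (Suc k) > \<eta>\<^sup>2 * L\<^sup>2)"
    have K: "\<beta> (Suc K) > \<eta>\<^sup>2 * L\<^sup>2" unfolding K_def
      by (rule LeastI[of _ m]) (use False m in simp)
    have "K \<le> m" unfolding K_def by (rule Least_le) (use False m in simp)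
    then have Kn: "K \<le> n" using m by simp
    have \<beta>K: "\<beta> K \<le> \<eta>\<^sup>2 * L\<^sup>2"
    proof (cases K)
      case 0
      then show ?thesis by (simp add: \<beta>0)
    next
      case (Suc j)
      then show ?thesis using not_less_Least[of j "\<lambda>k. \<beta> (Suc k) > \<eta>\<^sup>2 * L\<^sup>2"] by (simp add: K_def)
    qed
    define r where "r = sqrt (\<beta> n)"
    have r: "r > 0" "r\<^sup>2 = \<beta> n" using \<beta>pos[of m] m by (simp_all add: r_def)
    \<comment> \<open>Each square root is replaced by the last one, \<open>r\<close>; this is
      allowed because the decrements of \<open>F\<close> are nonnegative from \<open>K\<close> on,
      and what remains telescopes.\<close>
    have tel: "\<eta> * (\<beta> j - \<beta> K) \<le> r * (2 * (F K - F j))" if "K \<le> j" "j \<le> n" for j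
      using that
    proof (induction j rule: dec_induct)
      case base
      then show ?case by simp
    next
      case (step j)
      have gt: "\<beta> (Suc j) > \<eta>\<^sup>2 * L\<^sup>2" using K mono[of "Suc K" "Suc j"] step by simp
      have sr: "0 < sqrt (\<beta> (Suc j))" "sqrt (\<beta> (Suc j)) \<le> r"
        using \<beta>pos[of j] mono[of "Suc j" n] step by (simp_all add: r_def)
      have d: "\<eta> * (g j)\<^sup>2 \<le> sqrt (\<beta> (Suc j)) * (2 * (F j - F (Suc j)))" by (rule decrease[OF gt])
      moreover have "0 \<le> \<eta> * (g j)\<^sup>2" using \<eta> by simp
      ultimately have "0 \<le> sqrt (\<beta> (Suc j)) * (2 * (F j - F (Suc j)))" by linarith
      then have "0 \<le> 2 * (F j - F (Suc j))" using sr(1) by (simp only: zero_le_mult_iff) linarith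
      with sr(2) have "sqrt (\<beta> (Suc j)) * (2 * (F j - F (Suc j))) \<le> r * (2 * (F j - F (Suc j)))"
        by (rule mult_right_mono)
      with d have "\<eta> * (g j)\<^sup>2 \<le> r * (2 * (F j - F (Suc j)))" by linarith
      then show ?case using step by (simp add: \<beta>S algebra_simps)
    qed
    have "2 * (F K - F n) \<le> E"
    proof -
      have "2 * F K \<le> 2 * F 0 + L * \<eta>\<^sup>2 / (g 0)\<^sup>2 * \<beta> K" using increase[of K] by simp
      also have "\<dots> \<le> 2 * F 0 + L * \<eta>\<^sup>2 / (g 0)\<^sup>2 * (\<eta>\<^sup>2 * L\<^sup>2)"
        using \<beta>K L by (intro add_left_mono mult_left_mono) auto
      also have "\<dots> = 2 * F 0 + \<eta> ^ 4 * L ^ 3 / (g 0)\<^sup>2" by (simp add: power_numeral_reduce)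
      finally show ?thesis using fmin[of n] by (simp add: E_def)
    qed
    then have "r * (2 * (F K - F n)) \<le> r * E" using r(1) by simp
    with tel[OF Kn order_refl] have main: "\<eta> * (\<beta> n - \<beta> K) \<le> r * E" by linarith
    \<comment> \<open>Only one of the two roots is bounded by \<eta> L. The other is bounded by
      \<open>r\<close>, so that every term of the inequality for \<eta> r^2 carries a factor
      \<open>r\<close> to cancel.\<close>
    have "\<beta> K = sqrt (\<beta> K) * sqrt (\<beta> K)" using \<beta>nn[of K] by simp
    also have "\<dots> \<le> r * (\<eta> * L)"
    proof (rule mult_mono)
      show "sqrt (\<beta> K) \<le> r" using mono[OF Kn] by (simp add: r_def)
      have "sqrt (\<beta> K) \<le> sqrt ((\<eta> * L)\<^sup>2)" using \<beta>K by (simp add: power_mult_distrib)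
      then show "sqrt (\<beta> K) \<le> \<eta> * L" using \<eta> L by simp
    qed (use r \<beta>nn in auto)
    finally have "\<eta> * \<beta> K \<le> \<eta> * (r * (\<eta> * L))" using \<eta> by (intro mult_left_mono) auto
    then have "r * (\<eta> * r) \<le> r * (E + \<eta>\<^sup>2 * L)"
      using main r(2) by (simp add: power2_eq_square algebra_simps)
    then have "\<eta> * r \<le> E + \<eta>\<^sup>2 * L" using r(1) by simp
    then have rS: "r / \<eta> \<le> S" using \<eta> by (simp add: SE field_simps power2_eq_square)
    \<comment> \<open>The bound on \<open>r\<close> is fed back into the inequality that produced
      it.\<close>
    have "\<beta> n - \<beta> K \<le> E * (r / \<eta>)" using main \<eta> by (simp add: field_simps)
    also have "\<dots> \<le> E * S" using rS E by (rule mult_left_mono)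
    finally show ?thesis using small[OF \<beta>K] by (simp add: E_def algebra_simps)
  qed
qed

theorem theorem4p1:
  fixes M :: "('m::{t2_space, second_countable_topology}, 'e::euclidean_space) riemannian"
    and f :: "'m \<Rightarrow> real" and L \<eta> \<epsilon> fstar \<alpha>min :: real and x0 xstar :: 'm
    and x :: "nat \<Rightarrow> 'm" and \<beta> \<alpha> :: "nat \<Rightarrow> real"
  assumes "complete_riemannian_manifold M"
    and "differentiable_fun M f"
    and "L \<ge> 0" and "lipschitz_grad M f L"
    and "\<forall>p. f xstar \<le> f p" and "fstar = f xstar"
    and "\<eta> > 0" and "grad M f x0 \<noteq> (\<lambda>_. 0)"
    and "madagrad M f \<eta> x0 x \<beta> \<alpha>"
    and "\<alpha>min = inverse (L + 2 * (f x0 - fstar) / \<eta>\<^sup>2 + \<eta>\<^sup>2 * L ^ 3 / (tnorm M x0 (grad M f x0))\<^sup>2)"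
    and "\<epsilon> > 0"
  shows "ereal_of_enat (first_stationary M f x \<epsilon>) \<le>
    ereal ((\<eta> ^ 3 * L\<^sup>2 / (\<alpha>min * tnorm M x0 (grad M f x0))
            + 2 * (f x0 - fstar) / \<alpha>min
            + \<eta> ^ 4 * L ^ 3 / (\<alpha>min * (tnorm M x0 (grad M f x0))\<^sup>2)) / \<epsilon>\<^sup>2)"
proof -
  interpret riemannian_mfd M
    using assms(1) by unfold_locales (simp add: complete_riemannian_manifold_def)
  define g where "g k = tnorm M (x k) (grad M f (x k))" for k
  define S where "S = L + 2 * (f x0 - fstar) / \<eta>\<^sup>2 + \<eta>\<^sup>2 * L ^ 3 / (g 0)\<^sup>2"
  define B where "B = (\<eta> ^ 3 * L\<^sup>2 / g 0 + 2 * (f x0 - fstar) + \<eta> ^ 4 * L ^ 3 / (g 0)\<^sup>2) * S"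
  note tan = grad_in_tangent_space[OF assms(2)]
  have x0: "x 0 = x0" and \<beta>0: "\<beta> 0 = 0" and \<beta>S: "\<And>k. \<beta> (Suc k) = \<beta> k + (g k)\<^sup>2"
    and \<alpha>: "\<And>k. \<alpha> k = \<eta> / sqrt (\<beta> (Suc k))"
    and step: "\<And>k. x (Suc k) = riem_exp M (x k) (\<lambda>c. (- \<alpha> k) *\<^sub>R grad M f (x k) c)"
    using assms(9) unfolding madagrad_def g_def by blast+
  have g0: "g 0 > 0" unfolding g_def x0 by (rule tnorm_pos[OF tan assms(8)])
  have \<alpha>min: "\<alpha>min = inverse S" unfolding assms(10) S_def g_def x0 ..
  have desc: "f (x (Suc k)) \<le> f (x k) - \<eta> / sqrt (\<beta> (Suc k)) * (g k)\<^sup>2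
      + L / 2 * (\<eta> / sqrt (\<beta> (Suc k)))\<^sup>2 * (g k)\<^sup>2" for k
  proof -
    let ?G = "grad M f (x k)" and ?v = "\<lambda>c. (- \<alpha> k) *\<^sub>R grad M f (x k) c"
    have v: "?v \<in> tangent_space M (x k)" by (rule tangent_space_scaleR[OF tan])
    have "metric M (x k) ?v ?G = - \<alpha> k * (g k)\<^sup>2"
      unfolding metric_scaleR[OF tan tan] g_def tnorm_power2[OF tan] ..
    then have Gv: "metric M (x k) ?G ?v = - \<alpha> k * (g k)\<^sup>2" using metric_sym[OF tan v] by simp
    have vv: "metric M (x k) ?v ?v = (\<alpha> k)\<^sup>2 * (g k)\<^sup>2"
      unfolding metric_scaleR[OF tan v] Gv by (simp add: power2_eq_square)
    show ?thesis
      using descent_inequality[OF assms(1-4) v] unfolding Gv vv step[symmetric] by (simp add: \<alpha>)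
  qed
  have bound: "\<beta> n \<le> B" for n
    unfolding B_def x0[symmetric]
    by (rule adagrad_accumulator_bound[OF assms(7,3) g0 \<beta>0 \<beta>S desc])
      (use assms(5,6) x0 in \<open>simp_all add: S_def\<close>)
  have lower: "real n * \<epsilon>\<^sup>2 \<le> \<beta> n" if "\<And>k. k < n \<Longrightarrow> g k > \<epsilon>" for n
    using that
  proof (induction n)
    case 0
    then show ?case by (simp add: \<beta>0)
  next
    case (Suc n)
    have "\<epsilon>\<^sup>2 \<le> (g n)\<^sup>2" using Suc.prems[of n] assms(11) by (intro power_mono) auto
    moreover have "real n * \<epsilon>\<^sup>2 \<le> \<beta> n" using Suc by simp
    ultimately show ?case by (simp add: \<beta>S algebra_simps)
  qed
  \<comment> \<open>Each gradient norm above \<epsilon> adds more than \<epsilon>^2 to the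
    accumulator, which never exceeds \<open>B\<close>.\<close>
  have le: "real n \<le> B / \<epsilon>\<^sup>2" if "\<And>k. k < n \<Longrightarrow> g k > \<epsilon>" for n
  proof -
    have "real n * \<epsilon>\<^sup>2 \<le> \<beta> n" using that by (rule lower)
    then show ?thesis using bound[of n] assms(11) by (simp add: field_simps)
  qed
  \<comment> \<open>Were all gradient norms above \<epsilon>, every natural number would be at most
    B / \<epsilon>^2. So the set of stationary indices is nonempty and has a least element.\<close>
  obtain n where "real n > B / \<epsilon>\<^sup>2" using reals_Archimedean2 by blast
  then have "\<exists>k. g k \<le> \<epsilon>" using le[of n] by (meson not_le)
  then have T: "g (LEAST k. g k \<le> \<epsilon>) \<le> \<epsilon>" by (rule LeastI_ex)
  let ?T = "LEAST k. g k \<le> \<epsilon>"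
  have "first_stationary M f x \<epsilon> \<le> enat ?T"
    unfolding first_stationary_def g_def[symmetric] using T by (intro Inf_lower) blast
  then have "ereal_of_enat (first_stationary M f x \<epsilon>) \<le> ereal_of_enat (enat ?T)"
    by (simp only: ereal_of_enat_le_iff)
  also have "\<dots> \<le> ereal (B / \<epsilon>\<^sup>2)"
  proof -
    have "real ?T \<le> B / \<epsilon>\<^sup>2"
    proof (rule le)
      show "g k > \<epsilon>" if "k < ?T" for k using not_less_Least[OF that] by (rule not_le_imp_less)
    qed
    then show ?thesis by simp
  qed
  \<comment> \<open>Dividing by \<open>\<alpha>min\<close> is multiplying by \<open>S\<close>. With
    the convention that the inverse of 0 is 0, this needs no case distinction on
    \<open>S\<close>.\<close>
  also have "B = \<eta> ^ 3 * L\<^sup>2 / (\<alpha>min * tnorm M x0 (grad M f x0))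
            + 2 * (f x0 - fstar) / \<alpha>min
            + \<eta> ^ 4 * L ^ 3 / (\<alpha>min * (tnorm M x0 (grad M f x0))\<^sup>2)"
    unfolding B_def \<alpha>min g_def x0 by (simp add: divide_inverse distrib_right distrib_left mult_ac)
  finally show ?thesis .
qed

end
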